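(* Consider the finite-sum setting of the context, with Assumption A' ($G$ convex on $X$, $F$ possibly nonconvex). Let $\varsigma>0$, $q\in\{1,\dots,n\}$, $S=q$, $p=\frac12$, $\omega=\frac34$, and let $\{x_t\}_{t\ge0}$ be generated by Algorithm IR-FSCG (see context) with $\alpha_t=\log(q+1)/(q+1)$ for $0\le t\le q$, $\alpha_t=(t+1)^{-\omega}$ for $t>q$, and $\sigma_t=\varsigma(\max\{t,q+1\}+1)^{-p}$ for $t\ge0$. Define $$\beta_i=\begin{cases}\dfrac{\sigma_0(q+1)^\omega\log(q+1)}{q+1}\Big(1-\dfrac{\log(q+1)}{q+1}\Big)^{q-i},&0\le i\le q,\\[1ex]\sigma_i,&i>q.\end{cases}$$ Then there is a constant $C>0$, which may depend on the problem data $(X,f_i,g_i)$, on $\varsigma$ and on $q$ but not on $t$ or $\delta$, such that for every $\delta\in(0,1)$, with probability at least $1-\delta$, for every $t\ge q$ the following hold jointly: $$\frac{\sum_{i=0}^t\beta_i\mathcal{F}(x_i)}{\sum_{i=0}^t\beta_i}\le C\,t^{-1/4}\log\!\big(8d(t+2)^2/\delta\big),\qquad\mathcal{G}(x_t)\le C\,t^{-1/4}\log\!\big(8d(t+2)^2/\delta\big).$$ Moreover, with probability $1$, $$\liminf_{t\to\infty}\mathcal{F}(x_t)=0,\qquad\lim_{t\to\infty}\mathcal{G}(x_t)=0.$$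
   Context: Norms are Euclidean; $[m]=\{1,\dots,m\}$. Finite-sum setting: $X\subseteq\mathbb{R}^d$, $F=\frac1n\sum_{i\in[n]}f_i$, $G=\frac1n\sum_{i\in[n]}g_i$. Set $G_{\mathrm{opt}}=\min_{z\in X}G(z)$, $X_{\mathrm{opt}}=\arg\min_{z\in X}G(z)$. For $x\in X$ define $\mathcal{F}(x)=\max_{v\in X_{\mathrm{opt}}}\nabla F(x)^\top(x-v)$ and $\mathcal{G}(x)=G(x)-G_{\mathrm{opt}}$. Assumption A': (a) $X$ is convex and compact with diameter $D<\infty$, i.e. $\|x-y\|\le D$ for all $x,y\in X$. (b) $G$ is convex over $X$, and $F,G$ are continuously differentiable on an open neighborhood of $X$. (c) Each $f_i$ is continuously differentiable on an open neighborhood of $X$ with $\|\nabla f_i(x)-\nabla f_i(y)\|\le L_f\|x-y\|$ for $x,y\in X$. (d) Each $g_i$ is continuously differentiable on an open neighborhood of $X$ with $\nabla g_i$ $L_g$-Lipschitz in the same sense. Algorithm IR-FSCG, with parameters $\{\alpha_t\}\subseteq[0,1]$, $\{\sigma_t\}\subset(0,\infty)$, $S,q\in[n]$: start from a (deterministic) $x_0\in X$. For $t=0,1,2,\dots$: if $t\equiv0\pmod q$, put $\widehat{\nabla F}_t=\nabla F(x_t)$, $\widehat{\nabla G}_t=\nabla G(x_t)$; otherwise draw (independently of all previous iterations) $S$ i.i.d. uniform indices $\theta_1,\dots,\theta_S$ from $[n]$ and $S$ i.i.d. uniform indices $\xi_1,\dots,\xi_S$ from $[n]$, and put $\widehat{\nabla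 F}_t=\widehat{\nabla F}_{t-1}+\frac1S\sum_{j=1}^S(\nabla f_{\theta_j}(x_t)-\nabla f_{\theta_j}(x_{t-1}))$, $\widehat{\nabla G}_t=\widehat{\nabla G}_{t-1}+\frac1S\sum_{j=1}^S(\nabla g_{\xi_j}(x_t)-\nabla g_{\xi_j}(x_{t-1}))$. Choose $v_t\in\arg\min_{v\in X}(\sigma_t\widehat{\nabla F}_t+\widehat{\nabla G}_t)^\top v$ (a measurable choice depending only on the samples so far) and set $x_{t+1}=x_t+\alpha_t(v_t-x_t)$. *)

theory Defs
  imports "HOL-Probability.Probability"
begin

section \<open>Problem data\<close>

definition grad :: "('a::euclidean_space \<Rightarrow> real) \<Rightarrow> 'a \<Rightarrow> 'a" where
  "grad h x = (THE D. GDERIV h x :> D)"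

definition C1_near :: "'a::euclidean_space set \<Rightarrow> ('a \<Rightarrow> real) \<Rightarrow> bool" where
  "C1_near X h \<longleftrightarrow>
     (\<exists>U. open U \<and> X \<subseteq> U \<and> (\<forall>x\<in>U. h differentiable (at x)) \<and> continuous_on U (grad h))"

definition finite_avg :: "nat \<Rightarrow> (nat \<Rightarrow> 'a \<Rightarrow> real) \<Rightarrow> 'a \<Rightarrow> real" where
  "finite_avg n f x = (1 / real n) * (\<Sum>i\<in>{1..n}. f i x)"

locale bilevel_finite_sum =
  fixes X :: "'a::euclidean_space set" and n :: nat
    and f g :: "nat \<Rightarrow> 'a \<Rightarrow> real" and D Lf Lg :: real
  assumes convex_X: "convex X"
    and compact_X: "compact X"
    and diameter_X: "\<forall>x\<in>X. \<forall>y\<in>X. norm (x - y) \<le> D"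
    and convex_G: "convex_on X (finite_avg n g)"
    and C1_F: "C1_near X (finite_avg n f)"
    and C1_G: "C1_near X (finite_avg n g)"
    and C1_f: "\<forall>i\<in>{1..n}. C1_near X (f i)"
    and lipschitz_f: "\<forall>i\<in>{1..n}. Lf-lipschitz_on X (grad (f i))"
    and C1_g: "\<forall>i\<in>{1..n}. C1_near X (g i)"
    and lipschitz_g: "\<forall>i\<in>{1..n}. Lg-lipschitz_on X (grad (g i))"

definition lower_opt_set :: "'a::euclidean_space set \<Rightarrow> ('a \<Rightarrow> real) \<Rightarrow> 'a set" where
  "lower_opt_set X G = {z. is_arg_min G (\<lambda>z. z \<in> X) z}"

text \<open>
  For nonempty compact \<open>X\<close> and functions that are \<open>C\<^sup>1\<close> near \<open>X\<close>, the supremum and the infimum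
  below are attained, so they are the maximum over the lower-level solution set and the minimum
  over \<open>X\<close>.
\<close>

definition upper_gap :: "'a::euclidean_space set \<Rightarrow> ('a \<Rightarrow> real) \<Rightarrow> ('a \<Rightarrow> real) \<Rightarrow> 'a \<Rightarrow> real" where
  "upper_gap X F G x = (SUP v\<in>lower_opt_set X G. grad F x \<bullet> (x - v))"

definition lower_gap :: "'a::euclidean_space set \<Rightarrow> ('a \<Rightarrow> real) \<Rightarrow> 'a \<Rightarrow> real" where
  "lower_gap X G x = G x - (INF z\<in>X. G z)"

section \<open>The algorithm\<close>

text \<open>
  The index sample of iteration \<open>t\<close> consists of \<open>S\<close> indices for the upper-level and \<open>S\<close> indices for
  the lower-level gradient estimator. Samples are drawn only in iterations \<open>t\<close> with \<open>\<not> q dvd t\<close>;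
  values of \<open>\<theta> t\<close> and \<open>\<xi> t\<close> for other \<open>t\<close> play no role.
\<close>

definition sample_space :: "nat \<Rightarrow> nat \<Rightarrow> ((nat \<Rightarrow> nat) \<times> (nat \<Rightarrow> nat)) measure" where
  "sample_space n S =
     (\<Pi>\<^sub>M j\<in>{1..S}. count_space {1..n}) \<Otimes>\<^sub>M (\<Pi>\<^sub>M j\<in>{1..S}. count_space {1..n})"

definition sample ::
  "nat \<Rightarrow> (nat \<Rightarrow> nat \<Rightarrow> 'w \<Rightarrow> nat) \<Rightarrow> (nat \<Rightarrow> nat \<Rightarrow> 'w \<Rightarrow> nat) \<Rightarrow> nat \<Rightarrow> 'w
     \<Rightarrow> (nat \<Rightarrow> nat) \<times> (nat \<Rightarrow> nat)" where
  "sample S \<theta> \<xi> t \<omega> = ((\<lambda>j\<in>{1..S}. \<theta> t j \<omega>), (\<lambda>j\<in>{1..S}. \<xi> t j \<omega>))"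

text \<open>The \<open>\<sigma>\<close>-algebra generated by all samples drawn up to and including iteration \<open>t\<close>.\<close>

definition history ::
  "'w measure \<Rightarrow> nat \<Rightarrow> nat \<Rightarrow> nat \<Rightarrow> (nat \<Rightarrow> nat \<Rightarrow> 'w \<Rightarrow> nat) \<Rightarrow> (nat \<Rightarrow> nat \<Rightarrow> 'w \<Rightarrow> nat)
     \<Rightarrow> nat \<Rightarrow> 'w measure" where
  "history M n S q \<theta> \<xi> t =
     vimage_algebra (space M) (\<lambda>\<omega>. \<lambda>s\<in>{s. s \<le> t \<and> \<not> q dvd s}. sample S \<theta> \<xi> s \<omega>)
       (\<Pi>\<^sub>M s\<in>{s. s \<le> t \<and> \<not> q dvd s}. sample_space n S)"

text \<open>
  A run on the probability space \<open>M\<close>: \<open>x\<close> are the iterates, \<open>v\<close> the linear minimization steps, and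
  \<open>Fh\<close>, \<open>Gh\<close> the gradient estimators. Nothing is assumed about the joint law of the \<open>\<theta>\<close>-part
  and the \<open>\<xi>\<close>-part of the sample within one iteration.
\<close>

locale ir_fscg = prob_space M
  for M :: "'w measure" +
  fixes X :: "'a::euclidean_space set" and n :: nat
    and f g :: "nat \<Rightarrow> 'a \<Rightarrow> real"
    and \<alpha> \<sigma> :: "nat \<Rightarrow> real" and S q :: nat
    and \<theta> \<xi> :: "nat \<Rightarrow> nat \<Rightarrow> 'w \<Rightarrow> nat"
    and x v Fh Gh :: "nat \<Rightarrow> 'w \<Rightarrow> 'a" and x0 :: 'a
  assumes start: "x0 \<in> X" "\<forall>\<omega>\<in>space M. x 0 \<omega> = x0"
    and indep_iterations: "indep_vars (\<lambda>_. sample_space n S) (sample S \<theta> \<xi>) {t. \<not> q dvd t}"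
    and indep_\<theta>: "\<forall>t. \<not> q dvd t \<longrightarrow> indep_vars (\<lambda>_. count_space {1..n}) (\<theta> t) {1..S}"
    and indep_\<xi>: "\<forall>t. \<not> q dvd t \<longrightarrow> indep_vars (\<lambda>_. count_space {1..n}) (\<xi> t) {1..S}"
    and uniform_\<theta>: "\<forall>t. \<not> q dvd t \<longrightarrow> (\<forall>j\<in>{1..S}.
          distr M (count_space {1..n}) (\<theta> t j) = uniform_count_measure {1..n})"
    and uniform_\<xi>: "\<forall>t. \<not> q dvd t \<longrightarrow> (\<forall>j\<in>{1..S}.
          distr M (count_space {1..n}) (\<xi> t j) = uniform_count_measure {1..n})"
    and full_gradient: "\<forall>t. q dvd t \<longrightarrow> (\<forall>\<omega>\<in>space M.
          Fh t \<omega> = grad (finite_avg n f) (x t \<omega>) \<and> Gh t \<omega> = grad (finite_avg n g) (x t \<omega>))"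
    and Fh_update: "\<forall>t. \<not> q dvd t \<longrightarrow> (\<forall>\<omega>\<in>space M.
          Fh t \<omega> = Fh (t - 1) \<omega> + (1 / real S) *\<^sub>R
            (\<Sum>j\<in>{1..S}. grad (f (\<theta> t j \<omega>)) (x t \<omega>) - grad (f (\<theta> t j \<omega>)) (x (t - 1) \<omega>)))"
    and Gh_update: "\<forall>t. \<not> q dvd t \<longrightarrow> (\<forall>\<omega>\<in>space M.
          Gh t \<omega> = Gh (t - 1) \<omega> + (1 / real S) *\<^sub>R
            (\<Sum>j\<in>{1..S}. grad (g (\<xi> t j \<omega>)) (x t \<omega>) - grad (g (\<xi> t j \<omega>)) (x (t - 1) \<omega>)))"
    and v_arg_min: "\<forall>t. \<forall>\<omega>\<in>space M.
          is_arg_min (\<lambda>u. (\<sigma> t *\<^sub>R Fh t \<omega> + Gh t \<omega>) \<bullet> u) (\<lambda>u. u \<in> X) (v t \<omega>)"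
    and v_adapted: "\<forall>t. v t \<in> borel_measurable (history M n S q \<theta> \<xi> t)"
    and x_update: "\<forall>t. \<forall>\<omega>\<in>space M. x (Suc t) \<omega> = x t \<omega> + \<alpha> t *\<^sub>R (v t \<omega> - x t \<omega>)"

section \<open>Parameter schedules\<close>

text \<open>Here \<open>w\<close> is the step-size exponent and \<open>p\<close> the regularization exponent.\<close>

definition step_size :: "real \<Rightarrow> nat \<Rightarrow> nat \<Rightarrow> real" where
  "step_size w q t =
     (if t \<le> q then ln (real q + 1) / (real q + 1) else (real t + 1) powr (- w))"

definition reg_param :: "real \<Rightarrow> real \<Rightarrow> nat \<Rightarrow> nat \<Rightarrow> real" where
  "reg_param \<zeta> p q t = \<zeta> * (real (max t (q + 1)) + 1) powr (- p)"

definition avg_weight :: "real \<Rightarrow> real \<Rightarrow> real \<Rightarrow> nat \<Rightarrow> nat \<Rightarrow> real" where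
  "avg_weight \<zeta> p w q i =
     (if i \<le> q
      then reg_param \<zeta> p q 0 * (real q + 1) powr w * ln (real q + 1) / (real q + 1)
             * (1 - ln (real q + 1) / (real q + 1)) ^ (q - i)
      else reg_param \<zeta> p q i)"

end

theory Submission
  imports Defs "HOL-Real_Asymp.Real_Asymp"
begin

text \<open>
  The constant \<open>C\<close> may depend on \<open>q\<close>, and this makes the estimates hold on every single sample path.
  Between two full gradient evaluations an estimator collects fewer than \<open>q\<close> increments, and by the
  Lipschitz bounds on the component gradients each of them deviates from the true gradient increment
  by at most a multiple of the length of the last step, whatever indices were drawn. Hence the
  estimation error at time \<open>t\<close> is at most a constant times \<open>t powr -(3/4)\<close>, the order of the step size
  (\<open>recursive_estimator_error\<close>). The good event is therefore the whole probability space, and the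
  logarithm in the bound, being at least 1, only weakens the pathwise estimate.

  For a fixed path write \<open>\<sigma>\<close>, \<open>\<alpha>\<close> for the current parameters, \<open>u t\<close> and \<open>\<gamma> t\<close> for the upper and the lower
  gap of \<open>x t\<close>, and \<open>\<phi> t \<ge> 0\<close> for the value of \<open>F\<close> at \<open>x t\<close> shifted by a constant. The descent inequality
  for \<open>\<sigma> F + G\<close>, the minimality of \<open>v t\<close> and the convexity of \<open>G\<close> give
  \<open>\<sigma> \<phi> (t+1) + \<gamma> (t+1) \<le> \<sigma> \<phi> t + \<gamma> t - \<alpha> (\<sigma> u t + \<gamma> t) + K \<alpha>\<^sup>2\<close> (\<open>frank_wolfe_step\<close>, \<open>path_recursion\<close>).
  Everything else is a consequence of this scalar recursion.

  \<^item> Since \<open>\<phi>\<close> moves by \<open>O(\<alpha>)\<close> per step and \<open>u\<close> is bounded, \<open>\<gamma>\<close> contracts by the factor \<open>1 - \<alpha>\<close> up to an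
    error \<open>O(\<alpha> \<sigma>)\<close>, and an induction gives the rate of the lower gap (\<open>lower_rate\<close>).

  \<^item> Dividing by \<open>\<alpha>\<close> isolates \<open>\<sigma> u t\<close>, and summation by parts leaves the increments of \<open>1/\<alpha>\<close>, which
    are of order \<open>t powr -(1/4)\<close>. Their product with \<open>\<gamma> t\<close> is absorbed by the term \<open>-\<gamma> t\<close>, and their
    product with \<open>\<sigma> \<phi> t\<close> is of order \<open>t powr -(3/4)\<close>. So the weighted sum of the \<open>u t\<close> is of order
    \<open>t powr (1/4)\<close> (\<open>upper_sum_bound\<close>), while the sum of the weights is at least of order \<open>t powr (1/2)\<close>.

  \<^item> The divergence of the weights prevents \<open>u\<close> from staying above a positive number. Conversely \<open>\<gamma>\<close>
    tends to 0, so by compactness the iterates approach the lower-level solution set, and there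
    \<open>u\<close> is asymptotically nonnegative (\<open>upper_gap_asymp_nonneg\<close>). This is the statement on the
    limit inferior.
\<close>

section \<open>Gradients and first-order inequalities\<close>

lemma grad_eqI:
  assumes "GDERIV h x :> D"
  shows "grad h x = D"
  unfolding grad_def
proof (rule the_equality)
  show "GDERIV h x :> D" by fact
next
  fix D' assume "GDERIV h x :> D'"
  then have "(\<lambda>y. y \<bullet> D') = (\<lambda>y. y \<bullet> D)"
    using assms unfolding gderiv_def by (rule has_derivative_unique)
  then have "y \<bullet> D' = y \<bullet> D" for y
    by (rule fun_cong)
  then show "D' = D"
    by (metis vector_eq_rdot inner_commute)
qed

text \<open>
  The Riesz representation of the derivative, so that the definite description in \<open>grad\<close> denotes
  the gradient.
\<close>

lemma C1_near_GDERIV: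
  fixes h :: "'a::euclidean_space \<Rightarrow> real"
  assumes "C1_near X h" "x \<in> X"
  shows "GDERIV h x :> grad h x"
proof -
  obtain h' where h': "(h has_derivative h') (at x)"
    using assms unfolding C1_near_def differentiable_def by blast
  then interpret bounded_linear h'
    by (rule has_derivative_bounded_linear)
  define D where "D = (\<Sum>b\<in>Basis. h' b *\<^sub>R b)"
  have "h' = (\<lambda>y. y \<bullet> D)"
  proof
    fix y
    have "h' y = h' (\<Sum>b\<in>Basis. (y \<bullet> b) *\<^sub>R b)"
      by (simp add: euclidean_representation)
    also have "\<dots> = (\<Sum>b\<in>Basis. (y \<bullet> b) * h' b)"
      by (simp add: sum scaleR)
    finally show "h' y = y \<bullet> D"
      by (simp add: D_def inner_sum_right mult.commute)
  qed
  then have "GDERIV h x :> D"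
    using h' unfolding gderiv_def by simp
  then show ?thesis
    using grad_eqI by blast
qed

lemma DERIV_along_line:
  assumes "GDERIV h (x + s *\<^sub>R d) :> D"
  shows "((\<lambda>s. h (x + s *\<^sub>R d)) has_real_derivative (D \<bullet> d)) (at s)"
proof -
  have "((\<lambda>s. x + s *\<^sub>R d) has_derivative (\<lambda>s. s *\<^sub>R d)) (at s)"
    by (auto intro!: derivative_eq_intros)
  then have "((\<lambda>s. h (x + s *\<^sub>R d)) has_derivative (\<lambda>s. (s *\<^sub>R d) \<bullet> D)) (at s)"
    using has_derivative_compose[of "\<lambda>s. x + s *\<^sub>R d" "\<lambda>s. s *\<^sub>R d" s UNIV h "\<lambda>y. y \<bullet> D"]
      assms unfolding gderiv_def by simp
  moreover have "(\<lambda>s. (s *\<^sub>R d) \<bullet> D) = (*) (D \<bullet> d)"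
    by (rule ext) (simp add: inner_commute[of d D])
  ultimately show ?thesis
    unfolding has_field_derivative_def by (simp only:)
qed

lemma gradient_mvt:
  assumes "convex X" "x \<in> X" "y \<in> X"
    and grad: "\<And>z. z \<in> X \<Longrightarrow> GDERIV h z :> h' z"
  obtains z where "z \<in> X" "norm (z - x) \<le> norm (y - x)" "h y - h x = h' z \<bullet> (y - x)"
proof -
  define c where "c s = x + s *\<^sub>R (y - x)" for s
  have c: "c s \<in> X" if "s \<in> {0..1}" for s
  proof -
    have "(1 - s) *\<^sub>R x + s *\<^sub>R y \<in> X"
      using assms that by (intro convexD) auto
    then show ?thesis by (simp add: c_def algebra_simps)
  qed
  have "DERIV (\<lambda>s. h (c s)) s :> h' (c s) \<bullet> (y - x)" if "0 \<le> s" "s \<le> 1" for s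
    unfolding c_def using DERIV_along_line[OF grad[OF c[of s, unfolded c_def]]] that by simp
  then obtain s where s: "0 < s" "s < 1" "h (c 1) - h (c 0) = (1 - 0) * (h' (c s) \<bullet> (y - x))"
    using MVT2[of 0 1 "\<lambda>s. h (c s)" "\<lambda>s. h' (c s) \<bullet> (y - x)"] by auto
  show ?thesis
  proof (rule that)
    show "c s \<in> X" using c s by auto
    show "norm (c s - x) \<le> norm (y - x)"
      using s by (simp add: c_def mult_left_le_one_le)
    show "h y - h x = h' (c s) \<bullet> (y - x)"
      using s by (simp add: c_def)
  qed
qed

text \<open>
  The mean value theorem together with the Lipschitz bound gives the quadratic term with constant
  \<open>L\<close>; the sharper \<open>L / 2\<close> would only change constants.
\<close>

lemma descent_inequality:
  assumes "convex X" "x \<in> X" "y \<in> X"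
    and grad: "\<And>z. z \<in> X \<Longrightarrow> GDERIV h z :> h' z"
    and lip: "L-lipschitz_on X h'"
  shows "h y \<le> h x + h' x \<bullet> (y - x) + L * (norm (y - x))\<^sup>2"
proof -
  obtain z where z: "z \<in> X" "norm (z - x) \<le> norm (y - x)" "h y - h x = h' z \<bullet> (y - x)"
    using gradient_mvt[OF assms(1-3) grad] by blast
  have "(h' z - h' x) \<bullet> (y - x) \<le> norm (h' z - h' x) * norm (y - x)"
    by (rule norm_cauchy_schwarz)
  also have "\<dots> \<le> (L * norm (z - x)) * norm (y - x)"
    using lipschitz_onD[OF lip z(1) assms(2)] by (intro mult_right_mono) (auto simp: dist_norm)
  also have "\<dots> \<le> (L * norm (y - x)) * norm (y - x)"
    using z(2) lipschitz_on_nonneg[OF lip] by (intro mult_right_mono mult_left_mono) auto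
  finally show ?thesis
    using z(3) by (simp add: inner_diff_left power2_eq_square mult.assoc)
qed

text \<open>
  The difference quotients of a convex function along a segment are at most its increment over the
  whole segment. As \<open>x\<close> may lie on the boundary of \<open>X\<close>, only the limit from the right is taken.
\<close>

lemma convex_on_above_tangent:
  assumes "convex_on X h" "x \<in> X" "y \<in> X" and grad: "GDERIV h x :> D"
  shows "D \<bullet> (y - x) \<le> h y - h x"
proof -
  define c where "c s = h (x + s *\<^sub>R (y - x))" for s
  have "DERIV c 0 :> D \<bullet> (y - x)"
    unfolding c_def using DERIV_along_line[of h x 0 "y - x" D] grad by simp
  then have "((\<lambda>s. (c s - c 0) / s) \<longlongrightarrow> D \<bullet> (y - x)) (at_right 0)"
    unfolding has_field_derivative_iff by (auto intro: tendsto_within_subset)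
  moreover have "eventually (\<lambda>s. (c s - c 0) / s \<le> h y - h x) (at_right 0)"
    using eventually_at_right_real[OF zero_less_one]
  proof eventually_elim
    case (elim s)
    then have "h ((1 - s) *\<^sub>R x + s *\<^sub>R y) \<le> (1 - s) * h x + s * h y"
      using assms by (intro convex_onD[OF assms(1)]) auto
    moreover have "(1 - s) *\<^sub>R x + s *\<^sub>R y = x + s *\<^sub>R (y - x)"
      by (simp add: algebra_simps)
    ultimately have "c s - c 0 \<le> s * (h y - h x)"
      by (simp add: c_def algebra_simps)
    then show ?case
      using elim by (simp add: divide_le_eq mult.commute)
  qed
  ultimately show ?thesis
    by (rule tendsto_upperbound) simp
qed

lemma GDERIV_finite_avg:
  assumes "\<And>i. i \<in> {1..n} \<Longrightarrow> GDERIV (h i) x :> h' i"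
  shows "GDERIV (finite_avg n h) x :> (1 / real n) *\<^sub>R (\<Sum>i\<in>{1..n}. h' i)"
proof -
  have "((\<lambda>x. (1 / real n) * (\<Sum>i\<in>{1..n}. h i x)) has_derivative
      (\<lambda>y. (1 / real n) * (\<Sum>i\<in>{1..n}. y \<bullet> h' i))) (at x)"
    using assms unfolding gderiv_def
    by (intro has_derivative_mult_right has_derivative_sum) auto
  then show ?thesis
    unfolding gderiv_def finite_avg_def[abs_def] by (simp add: inner_sum_right)
qed

lemma lipschitz_grad_finite_avg:
  assumes "n > 0"
    and C1: "\<forall>i\<in>{1..n}. C1_near X (h i)"
    and lip: "\<forall>i\<in>{1..n}. L-lipschitz_on X (grad (h i))"
  shows "L-lipschitz_on X (grad (finite_avg n h))"
proof (rule lipschitz_onI)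
  show "0 \<le> L"
    using lip[rule_format, of 1] assms(1) lipschitz_on_nonneg by auto
  have avg: "grad (finite_avg n h) x = (1 / real n) *\<^sub>R (\<Sum>i\<in>{1..n}. grad (h i) x)"
    if "x \<in> X" for x
    by (rule grad_eqI, rule GDERIV_finite_avg, rule C1_near_GDERIV[OF C1[rule_format] that])
  fix x y assume xy: "x \<in> X" "y \<in> X"
  have "norm (\<Sum>i\<in>{1..n}. grad (h i) x - grad (h i) y) \<le> (\<Sum>i\<in>{1..n}. L * dist x y)"
    using lipschitz_onD[OF lip[rule_format] xy] unfolding dist_norm by (rule sum_norm_le)
  also have "\<dots> = real n * (L * dist x y)" by simp
  finally have "(1 / real n) * norm (\<Sum>i\<in>{1..n}. grad (h i) x - grad (h i) y) \<le> L * dist x y"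
    using assms(1) by (simp only: times_divide_eq_left mult_1_left pos_divide_le_eq of_nat_0_less_iff
        mult.commute)
  moreover have "grad (finite_avg n h) x - grad (finite_avg n h) y
      = (1 / real n) *\<^sub>R (\<Sum>i\<in>{1..n}. grad (h i) x - grad (h i) y)"
    unfolding avg[OF xy(1)] avg[OF xy(2)] by (simp only: sum_subtractf scaleR_diff_right)
  ultimately show "dist (grad (finite_avg n h) x) (grad (finite_avg n h) y) \<le> L * dist x y"
    by (simp add: dist_norm)
qed

section \<open>One conditional gradient step\<close>

text \<open>
  The comparison point \<open>z\<close> is arbitrary. Minimality of \<open>v\<close> for the estimated gradient allows
  replacing \<open>v\<close> by \<open>z\<close> in the linear term of the descent inequality, at the price of the estimation
  error times the diameter; convexity of \<open>G\<close> then turns its linear term into a difference of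
  function values, whereas for the possibly nonconvex \<open>F\<close> the linear term stays.
\<close>

lemma frank_wolfe_step:
  assumes "convex X" "x \<in> X" "z \<in> X"
    and F: "\<And>y. y \<in> X \<Longrightarrow> GDERIV F y :> F' y" "LF-lipschitz_on X F'"
    and G: "\<And>y. y \<in> X \<Longrightarrow> GDERIV G y :> G' y" "LG-lipschitz_on X G'" "convex_on X G"
    and diam: "\<And>y z. y \<in> X \<Longrightarrow> z \<in> X \<Longrightarrow> norm (y - z) \<le> D"
    and v: "is_arg_min (\<lambda>u. (s *\<^sub>R Fh + Gh) \<bullet> u) (\<lambda>u. u \<in> X) v"
    and "0 \<le> s" "0 \<le> a" "a \<le> 1"
    and y: "y = x + a *\<^sub>R (v - x)"
  shows "s * F y + G y \<le> s * F x + G x - a * (s * (F' x \<bullet> (x - z)) + (G x - G z))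
      + a * (D * (s * norm (Fh - F' x) + norm (Gh - G' x))) + a\<^sup>2 * D\<^sup>2 * (s * LF + LG)"
proof -
  have vX: "v \<in> X" using v by (simp add: is_arg_min_def)
  have "(1 - a) *\<^sub>R x + a *\<^sub>R v \<in> X"
    using assms vX by (intro convexD) auto
  then have yX: "y \<in> X" by (simp add: y algebra_simps)
  have D: "D \<ge> 0" using diam[OF \<open>x \<in> X\<close> \<open>x \<in> X\<close>] by simp
  have L: "0 \<le> LF" "0 \<le> LG" using F(2) G(2) lipschitz_on_nonneg by auto
  have nsq: "(norm (y - x))\<^sup>2 \<le> a\<^sup>2 * D\<^sup>2"
  proof -
    have "norm (y - x) \<le> a * D"
      using diam[OF vX \<open>x \<in> X\<close>] \<open>0 \<le> a\<close> by (simp add: y mult_left_mono)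
    then show ?thesis
      by (metis norm_ge_zero power_mono power_mult_distrib)
  qed
  have "F y \<le> F x + a * (F' x \<bullet> (v - x)) + LF * (a\<^sup>2 * D\<^sup>2)"
    using descent_inequality[OF assms(1,2) yX F] mult_left_mono[OF nsq L(1)] by (simp add: y)
  then have "s * F y \<le> s * (F x + a * (F' x \<bullet> (v - x)) + LF * (a\<^sup>2 * D\<^sup>2))"
    using \<open>0 \<le> s\<close> by (rule mult_left_mono)
  moreover have "G y \<le> G x + a * (G' x \<bullet> (v - x)) + LG * (a\<^sup>2 * D\<^sup>2)"
    using descent_inequality[OF assms(1,2) yX G(1,2)] mult_left_mono[OF nsq L(2)] by (simp add: y)
  moreover have "a * ((s *\<^sub>R F' x + G' x) \<bullet> (v - x)) \<le>
    a * (- (s * (F' x \<bullet> (x - z)) + (G x - G z))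
      + D * (s * norm (Fh - F' x) + norm (Gh - G' x)))"
  proof (rule mult_left_mono)
    \<comment> \<open>the error of the estimator for the gradient of \<open>s F + G\<close>\<close>
    define e where "e = s *\<^sub>R (Fh - F' x) + (Gh - G' x)"
    have "(s *\<^sub>R Fh + Gh) \<bullet> v \<le> (s *\<^sub>R Fh + Gh) \<bullet> z"
      using v \<open>z \<in> X\<close> by (auto simp: is_arg_min_def not_less)
    then have "(s *\<^sub>R F' x + G' x) \<bullet> (v - x) \<le> (s *\<^sub>R F' x + G' x) \<bullet> (z - x) + e \<bullet> (z - v)"
      by (simp add: e_def algebra_simps)
    moreover have "e \<bullet> (z - v) \<le> norm e * D"
      using diam[OF \<open>z \<in> X\<close> vX] by (meson norm_cauchy_schwarz mult_left_mono norm_ge_zero order_trans)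
    moreover have "norm e \<le> s * norm (Fh - F' x) + norm (Gh - G' x)"
      unfolding e_def using \<open>0 \<le> s\<close> norm_triangle_ineq[of "s *\<^sub>R (Fh - F' x)" "Gh - G' x"] by simp
    then have "norm e * D \<le> (s * norm (Fh - F' x) + norm (Gh - G' x)) * D"
      using D by (rule mult_right_mono)
    moreover have "G' x \<bullet> (z - x) \<le> G z - G x"
      using convex_on_above_tangent[OF G(3) \<open>x \<in> X\<close> \<open>z \<in> X\<close> G(1)[OF \<open>x \<in> X\<close>]] .
    ultimately show "(s *\<^sub>R F' x + G' x) \<bullet> (v - x) \<le>
      - (s * (F' x \<bullet> (x - z)) + (G x - G z)) + D * (s * norm (Fh - F' x) + norm (Gh - G' x))"
      by (simp add: algebra_simps)
  qed fact
  ultimately show ?thesis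
    by (simp add: algebra_simps)
qed

section \<open>Recursive gradient estimators\<close>

text \<open>
  The estimator is exact at the multiples of \<open>q\<close>. Each later update contributes at most twice
  \<open>L\<close> times the length of the last step: once for the sampled and once for the true gradient
  increment. There are fewer than \<open>q\<close> updates before the next reset, and within such a block the
  step bounds \<open>(t + 1) powr -(3/4)\<close> differ by at most a factor \<open>q\<close>. The bound holds for every choice of
  indices.
\<close>

lemma recursive_estimator_error:
  fixes E x :: "nat \<Rightarrow> 'a::euclidean_space" and H :: "nat \<Rightarrow> 'a \<Rightarrow> 'a"
  assumes "q > 0" "0 \<le> c" "0 \<le> L"
    and reset: "\<And>t. q dvd t \<Longrightarrow> E t = H' (x t)"
    and update: "\<And>t. \<not> q dvd t \<Longrightarrow> E t = E (t - 1)
        + (1 / real q) *\<^sub>R (\<Sum>j\<in>{1..q}. H (\<theta> t j) (x t) - H (\<theta> t j) (x (t - 1)))"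
    and idx: "\<And>t j. \<not> q dvd t \<Longrightarrow> j \<in> {1..q} \<Longrightarrow> \<theta> t j \<in> I"
    and x: "\<And>t. x t \<in> X"
    and lip: "\<And>i. i \<in> I \<Longrightarrow> L-lipschitz_on X (H i)" "L-lipschitz_on X H'"
    and steps: "\<And>t. norm (x (Suc t) - x t) \<le> c * (real t + 1) powr - (3/4)"
  shows "norm (E t - H' (x t)) \<le> 2 * L * c * real q ^ 2 * (real t + 1) powr - (3/4)"
proof -
  \<comment> \<open>the last reset up to time \<open>t\<close>\<close>
  define b where "b t = t - t mod q" for t :: nat
  have main: "norm (E t - H' (x t)) \<le> 2 * L * c * real (t mod q) * (real (b t) + 1) powr - (3/4)"
  proof (induction t)
    case 0
    then show ?case using reset[of 0] by simp
  next
    case (Suc t)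
    show ?case
    proof (cases "q dvd Suc t")
      case True
      then show ?thesis using reset by (simp add: dvd_eq_mod_eq_0)
    next
      case False
      then have mod: "Suc t mod q = Suc (t mod q)"
        by (simp add: mod_Suc dvd_eq_mod_eq_0 split: if_splits)
      have b: "b (Suc t) = b t" "b t \<le> t" unfolding b_def using mod by auto
      define d where "d = (1 / real q) *\<^sub>R
        (\<Sum>j\<in>{1..q}. H (\<theta> (Suc t) j) (x (Suc t)) - H (\<theta> (Suc t) j) (x t))"
      let ?a = "c * (real (b t) + 1) powr - (3/4)"
      have "norm (x (Suc t) - x t) \<le> c * (real t + 1) powr - (3/4)" by (rule steps)
      also have "\<dots> \<le> ?a"
        using b \<open>0 \<le> c\<close> by (intro mult_left_mono powr_mono2') auto
      finally have step: "L * norm (x (Suc t) - x t) \<le> L * ?a"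
        using \<open>0 \<le> L\<close> by (rule mult_left_mono)
      have "norm (\<Sum>j\<in>{1..q}. H (\<theta> (Suc t) j) (x (Suc t)) - H (\<theta> (Suc t) j) (x t))
          \<le> (\<Sum>j\<in>{1..q}. L * ?a)"
      proof (rule sum_norm_le)
        fix j assume "j \<in> {1..q}"
        then show "norm (H (\<theta> (Suc t) j) (x (Suc t)) - H (\<theta> (Suc t) j) (x t)) \<le> L * ?a"
          using lipschitz_onD[OF lip(1)[OF idx[OF False]] x x, of j "Suc t" t] step
          by (simp add: dist_norm)
      qed
      then have "norm d \<le> L * ?a"
        using \<open>q > 0\<close> by (simp add: d_def divide_simps mult.commute)
      moreover have "norm (H' (x (Suc t)) - H' (x t)) \<le> L * ?a"
        using lipschitz_onD[OF lip(2) x x, of "Suc t" t] step by (simp add: dist_norm)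
      moreover have "E (Suc t) - H' (x (Suc t)) = (E t - H' (x t)) + (d - (H' (x (Suc t)) - H' (x t)))"
        using update[OF False] by (simp add: d_def)
      then have "norm (E (Suc t) - H' (x (Suc t)))
          \<le> norm (E t - H' (x t)) + (norm d + norm (H' (x (Suc t)) - H' (x t)))"
        by (metis norm_triangle_ineq norm_triangle_ineq4 add_left_mono order_trans)
      ultimately have "norm (E (Suc t) - H' (x (Suc t)))
          \<le> 2 * L * c * real (t mod q) * (real (b t) + 1) powr - (3/4) + 2 * (L * ?a)"
        using Suc.IH by linarith
      then show ?thesis
        by (simp add: mod b algebra_simps)
    qed
  qed
  have qb: "real t + 1 \<le> real q * (real (b t) + 1)"
  proof -
    have "t + 1 \<le> q + b t"
      using \<open>q > 0\<close> mod_less_divisor[of q t] mod_less_eq_dividend[of t q] unfolding b_def by linarith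
    also have "\<dots> \<le> q * (b t + 1)" using \<open>q > 0\<close> by simp
    finally have "real (t + 1) \<le> real (q * (b t + 1))" by (simp only: of_nat_le_iff)
    then show ?thesis by (simp add: algebra_simps)
  qed
  have "(real (b t) + 1) powr - (3/4) \<le> ((real t + 1) / real q) powr - (3/4)"
    using qb \<open>q > 0\<close> by (intro powr_mono2') (auto simp: divide_simps mult.commute)
  also have "\<dots> = real q powr (3/4) * (real t + 1) powr - (3/4)"
    using \<open>q > 0\<close> by (simp add: powr_divide powr_minus field_simps)
  also have "\<dots> \<le> real q * (real t + 1) powr - (3/4)"
    using \<open>q > 0\<close> powr_mono[of "3/4" 1 "real q"] by (intro mult_right_mono) auto
  finally have "real (t mod q) * (real (b t) + 1) powr - (3/4)
      \<le> real q * (real q * (real t + 1) powr - (3/4))"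
    using \<open>q > 0\<close> by (intro mult_mono) (auto intro: less_imp_le)
  then have "(2 * L * c) * (real (t mod q) * (real (b t) + 1) powr - (3/4))
      \<le> (2 * L * c) * (real q * (real q * (real t + 1) powr - (3/4)))"
    using \<open>0 \<le> c\<close> \<open>0 \<le> L\<close> by (intro mult_left_mono) auto
  then show ?thesis
    using main by (simp add: power2_eq_square mult.assoc)
qed

section \<open>Powers and averaging weights\<close>

lemma one_minus_powr_quarter_le:
  fixes y :: real
  assumes "0 \<le> y" "y \<le> 1"
  shows "(1 - y) powr (1/4) \<le> 1 - y / 4"
proof -
  have "1 - y \<le> (1 - y / 4) ^ 4"
    using Bernoulli_inequality[of "- y / 4" 4] assms by simp
  also have "\<dots> = (1 - y / 4) powr 4"
    using assms by (simp add: powr_numeral)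
  finally have "(1 - y) powr (1/4) \<le> ((1 - y / 4) powr 4) powr (1/4)"
    using assms by (intro powr_mono2) auto
  also have "\<dots> = 1 - y / 4"
    using assms by (subst powr_powr) simp
  finally show ?thesis .
qed

text \<open>
  Summed over \<open>y\<close>, the right-hand side telescopes: the partial sums of \<open>y powr -(3/4)\<close> are of order
  \<open>y powr (1/4)\<close>.
\<close>

lemma powr_quarter_increment:
  fixes y :: real
  assumes "1 \<le> y"
  shows "y powr - (3/4) \<le> 4 * (y powr (1/4) - (y - 1) powr (1/4))"
proof -
  have "(y - 1) powr (1/4) = (y * (1 - 1 / y)) powr (1/4)"
    using assms by (simp add: right_diff_distrib)
  also have "\<dots> = y powr (1/4) * (1 - 1 / y) powr (1/4)"
    using assms by (simp add: powr_mult)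
  also have "\<dots> \<le> y powr (1/4) * (1 - 1 / y / 4)"
    using assms one_minus_powr_quarter_le[of "1 / y"] by (intro mult_left_mono) auto
  also have "\<dots> = y powr (1/4) - y powr (1/4) / y / 4"
    by (simp add: algebra_simps)
  also have "y powr (1/4) / y = y powr - (3/4)"
    using assms powr_diff[of y "1/4" 1] by simp
  finally show ?thesis by simp
qed

text \<open>
  The increment of the inverse step size that summation by parts produces.
\<close>

lemma powr_three_quarters_increment:
  fixes y :: real
  assumes "1 \<le> y"
  shows "(y + 1) powr (3/4) \<le> y powr (3/4) + y powr - (1/4)"
proof -
  have "(1 + 1 / y) powr (3/4) \<le> (1 + 1 / y) powr 1"
    using assms by (intro powr_mono) auto
  then have "y powr (3/4) * (1 + 1 / y) powr (3/4) \<le> y powr (3/4) * (1 + 1 / y)"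
    using assms by (intro mult_left_mono) auto
  moreover have "(y + 1) powr (3/4) = y powr (3/4) * (1 + 1 / y) powr (3/4)"
    using assms by (simp add: distrib_left flip: powr_mult)
  moreover have "y powr (3/4) / y = y powr - (1/4)"
    using assms powr_diff[of y "3/4" 1] by simp
  ultimately show ?thesis by (simp add: algebra_simps)
qed

text \<open>
  How slowly the claimed rate of the lower gap decreases in one step; the contraction by the step
  size must be stronger than this.
\<close>

lemma powr_minus_quarter_decrement:
  fixes y :: real
  assumes "1 \<le> y"
  shows "y powr - (1/4) * (1 - 1 / (4 * y)) \<le> (y + 1) powr - (1/4)"
proof -
  have "1 - 1 / (4 * y) \<le> exp (- (1/4) * (1 / y))"
    using exp_ge_add_one_self[of "- (1/4) * (1 / y)"] by (simp add: field_simps)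
  also have "\<dots> \<le> exp (- (1/4) * ln (1 + 1 / y))"
    using assms ln_add_one_self_le_self[of "1 / y"] by simp
  also have "\<dots> = (1 + 1 / y) powr - (1/4)"
    using add_pos_pos[of 1 "1 / y"] assms by (simp add: powr_def)
  finally have "y powr - (1/4) * (1 - 1 / (4 * y)) \<le> y powr - (1/4) * (1 + 1 / y) powr - (1/4)"
    by (intro mult_left_mono) auto
  also have "\<dots> = (y + 1) powr - (1/4)"
    using assms by (simp add: distrib_left flip: powr_mult)
  finally show ?thesis .
qed

lemma ln_over_self_bounds:
  assumes "0 < q"
  shows "0 < ln (real q + 1) / (real q + 1)" "ln (real q + 1) / (real q + 1) < 1"
  using assms ln_less_self[of "real q + 1"] by auto

lemma avg_weight_pos:
  assumes "0 < \<zeta>" "0 < q"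
  shows "0 < avg_weight \<zeta> p w q i"
  using ln_over_self_bounds[OF assms(2)] assms unfolding avg_weight_def reg_param_def
  by auto

lemma avg_weight_late:
  "q < i \<Longrightarrow> avg_weight \<zeta> p w q i = \<zeta> * (real i + 1) powr - p"
  unfolding avg_weight_def reg_param_def by (simp add: max.absorb1)

text \<open>
  For \<open>t \<ge> q\<close> each of the \<open>t - q + 1 \<ge> t / q\<close> last weights is at least a constant times
  \<open>t powr -(1/2)\<close>.
\<close>

lemma sum_avg_weight_lower:
  assumes "0 < \<zeta>" "0 < q"
  shows "\<exists>c>0. \<forall>t\<ge>q. c * real t powr (1/2) \<le> (\<Sum>i\<le>t. avg_weight \<zeta> (1/2) w q i)"
proof -
  define \<beta> where "\<beta> = avg_weight \<zeta> (1/2) w q"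
  have \<beta>_pos: "0 < \<beta> i" for i unfolding \<beta>_def using assms by (rule avg_weight_pos)
  define b where "b = min \<zeta> (\<beta> q)"
  have b: "0 < b" "b \<le> \<zeta>" "b \<le> \<beta> q" unfolding b_def using \<beta>_pos assms by auto
  have "b / (2 * real q) * real t powr (1/2) \<le> (\<Sum>i\<le>t. \<beta> i)" if t: "q \<le> t" for t
  proof -
    have t1: "1 \<le> real t" using t assms by simp
    have "t \<le> q * (t - q + 1)"
    proof -
      obtain k where k: "t = q + k" using t le_Suc_ex by blast
      have "k \<le> q * k" using assms by simp
      then show ?thesis by (simp add: k)
    qed
    then have "real t \<le> real (q * (t - q + 1))" by (simp only: of_nat_le_iff)
    then have count: "real t / real q \<le> real (t - q + 1)"
      using assms by (simp add: field_simps)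
    have "b / (2 * real q) * real t powr (1/2) = b * (real t powr - (1/2) / 2) * (real t / real q)"
      using t1 powr_add[of "real t" "-(1/2)" 1] by (simp add: field_simps)
    also have "\<dots> \<le> b * (real t + 1) powr - (1/2) * real (t - q + 1)"
    proof (intro mult_mono count mult_left_mono)
      have "2 powr - 1 \<le> 2 powr - (1/2 :: real)"
        by (intro powr_mono) auto
      then have "real t powr - (1/2) * 2 powr - 1 \<le> real t powr - (1/2) * 2 powr - (1/2)"
        by (intro mult_left_mono) auto
      then have "real t powr - (1/2) / 2 \<le> real t powr - (1/2) * 2 powr - (1/2)"
        by (simp add: powr_minus_divide[of 2 1])
      also have "\<dots> = (real t * 2) powr - (1/2)" by (simp add: powr_mult)
      also have "\<dots> \<le> (real t + 1) powr - (1/2)"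
        using t1 by (intro powr_mono2') auto
      finally show "real t powr - (1/2) / 2 \<le> (real t + 1) powr - (1/2)" .
    qed (use b in auto)
    also have "\<dots> = (\<Sum>i\<in>{q..t}. b * (real t + 1) powr - (1/2))"
      using t by (simp add: Suc_diff_le)
    also have "\<dots> \<le> (\<Sum>i\<in>{q..t}. \<beta> i)"
    proof (rule sum_mono)
      fix i assume i: "i \<in> {q..t}"
      show "b * (real t + 1) powr - (1/2) \<le> \<beta> i"
      proof (cases "i = q")
        case True
        have "(real t + 1) powr - (1/2) \<le> 1"
          using powr_mono2'[of "-(1/2)" 1 "real t + 1"] by simp
        then have "b * (real t + 1) powr - (1/2) \<le> b * 1"
          using b by (intro mult_left_mono) auto
        also have "\<dots> \<le> \<beta> i" using b True by simp
        finally show ?thesis .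
      next
        case False
        then have "\<beta> i = \<zeta> * (real i + 1) powr - (1/2)"
          unfolding \<beta>_def using i by (intro avg_weight_late) auto
        moreover have "b * (real t + 1) powr - (1/2) \<le> \<zeta> * (real i + 1) powr - (1/2)"
          using b i assms by (intro mult_mono powr_mono2') auto
        ultimately show ?thesis by simp
      qed
    qed
    also have "\<dots> \<le> (\<Sum>i\<le>t. \<beta> i)"
      using \<beta>_pos by (intro sum_mono2) (auto intro: less_imp_le)
    finally show ?thesis .
  qed
  then show ?thesis
    unfolding \<beta>_def using b assms by (intro exI[of _ "b / (2 * real q)"]) auto
qed

section \<open>The scalar recursion for the two gaps\<close>

text \<open>
  What the convergence analysis retains of one sample path: \<open>\<phi>\<close> is the shifted value of \<open>F\<close>, \<open>\<gamma>\<close> the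
  lower gap and \<open>u\<close> the upper gap along the iterates. The recursion is stated only for \<open>t > q\<close>, where
  the step size and the regularization parameter are pure powers of \<open>t + 1\<close>; the finitely many earlier
  times enter through \<open>K\<close>.
\<close>

locale bilevel_recursion =
  fixes \<zeta> K :: real and q :: nat and \<phi> \<gamma> u :: "nat \<Rightarrow> real"
  assumes \<zeta>_pos: "\<zeta> > 0" and q_pos: "q > 0"
    and \<phi>_nonneg: "0 \<le> \<phi> t" and \<phi>_le: "\<phi> t \<le> K"
    and \<gamma>_nonneg: "0 \<le> \<gamma> t" and \<gamma>_le: "\<gamma> t \<le> K"
    and u_bound: "\<bar>u t\<bar> \<le> K"
    and drift: "t > q \<Longrightarrow> \<bar>\<phi> (Suc t) - \<phi> t\<bar> \<le> K * (real t + 1) powr - (3/4)"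
    and descent: "t > q \<Longrightarrow> s = \<zeta> * (real t + 1) powr - (1/2) \<Longrightarrow> a = (real t + 1) powr - (3/4) \<Longrightarrow>
        s * \<phi> (Suc t) + \<gamma> (Suc t) \<le> s * \<phi> t + \<gamma> t - a * (s * u t + \<gamma> t) + a * (K * a)"
begin

lemma K_nonneg: "0 \<le> K"
  using \<phi>_nonneg[of 0] \<phi>_le[of 0] by simp

text \<open>
  With \<open>b = (t + 1) powr -(1/4)\<close>, the step size is \<open>b^3\<close> and the regularization parameter is \<open>\<zeta> b^2\<close>.
  The recursion becomes \<open>\<gamma> (t + 1) \<le> (1 - b^3) \<gamma> t + b^3 K (1 + 2 \<zeta>) b\<close>, and the ansatz \<open>\<gamma> t \<le> C b\<close> gains
  \<open>(C - K (1 + 2 \<zeta>)) b^4\<close> in one step, more than the decrease \<open>C b^5 / 4\<close> of \<open>C b\<close>. The summand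
  \<open>K (q + 2)\<close> of \<open>C\<close> covers the times up to \<open>q + 1\<close>, for which only \<open>\<gamma> t \<le> K\<close> is known.
\<close>

lemma lower_rate:
  assumes C: "C = K * (real q + 2) + 2 * K * (1 + 2 * \<zeta>)"
  shows "\<gamma> t \<le> C * (real t + 1) powr - (1/4)"
proof (induction t)
  case 0
  have "0 \<le> K * real q" "0 \<le> K * \<zeta>"
    using K_nonneg \<zeta>_pos by auto
  moreover have "C = K * real q + 4 * K + 4 * (K * \<zeta>)"
    unfolding C by (simp add: algebra_simps)
  ultimately have "\<gamma> 0 \<le> C"
    using \<gamma>_le[of 0] K_nonneg by linarith
  then show ?case by simp
next
  case (Suc t)
  show ?case
  proof (cases "t > q")
    case False
    have "(real q + 2) powr (1/4) \<le> (real q + 2) powr 1"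
      by (intro powr_mono) auto
    then have "1 \<le> (real q + 2) * (real q + 2) powr - (1/4)"
      by (simp add: powr_minus_divide)
    then have "K * 1 \<le> K * ((real q + 2) * (real q + 2) powr - (1/4))"
      using K_nonneg by (rule mult_left_mono)
    also have "\<dots> = K * (real q + 2) * (real q + 2) powr - (1/4)"
      by simp
    also have "\<dots> \<le> C * (real (Suc t) + 1) powr - (1/4)"
      using False K_nonneg \<zeta>_pos unfolding C
      by (intro mult_mono powr_mono2') auto
    finally show ?thesis using \<gamma>_le[of "Suc t"] by simp
  next
    case True
    define b where "b = (real t + 1) powr - (1/4)"
    have b: "0 < b" "b \<le> 1"
      unfolding b_def using powr_mono2'[of "-(1/4)" 1 "real t + 1"] by auto
    have bk: "b ^ k = (real t + 1) powr (- real k / 4)" for k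
      using powr_realpow[OF b(1), of k] unfolding b_def by (simp add: powr_powr)
    have b2: "(real t + 1) powr - (1/2) = b\<^sup>2" and b3: "(real t + 1) powr - (3/4) = b ^ 3"
      and b4: "1 / (real t + 1) = b ^ 4"
      unfolding bk by (simp_all add: powr_minus_divide)
    have "b ^ 4 = b * b ^ 3" "b ^ 3 = b\<^sup>2 * b" by algebra+
    have b3_le: "b ^ 3 \<le> 1" using b by (simp add: power_le_one)
    have "\<zeta> * b\<^sup>2 * (\<phi> t - \<phi> (Suc t)) \<le> \<zeta> * b\<^sup>2 * (K * b ^ 3)"
      using drift[OF True] \<zeta>_pos b3 by (intro mult_left_mono) auto
    moreover have "b ^ 3 * (\<zeta> * b\<^sup>2 * (- u t)) \<le> b ^ 3 * (\<zeta> * b\<^sup>2 * K)"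
      using u_bound[of t] \<zeta>_pos b by (intro mult_left_mono) auto
    moreover have "b ^ 3 * (K * b ^ 3) \<le> b ^ 3 * (K * b\<^sup>2)"
      using b K_nonneg by (intro mult_left_mono power_decreasing) auto
    moreover have "b ^ 3 * (K * b\<^sup>2 * (1 + 2 * \<zeta>)) \<le> b ^ 3 * (K * b * (1 + 2 * \<zeta>))"
      using b K_nonneg \<zeta>_pos power_decreasing[of 1 2 b]
      by (intro mult_left_mono mult_right_mono) auto
    ultimately have "\<gamma> (Suc t) \<le> (1 - b ^ 3) * \<gamma> t + b ^ 3 * (K * b * (1 + 2 * \<zeta>))"
      using descent[OF True refl refl, unfolded b2 b3] by (simp add: algebra_simps)
    also have "\<dots> \<le> (1 - b ^ 3) * (C * b) + b ^ 3 * (K * b * (1 + 2 * \<zeta>))"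
      using Suc.IH b3_le unfolding b_def[symmetric] by (intro add_right_mono mult_left_mono) auto
    also have "\<dots> = C * b - b ^ 4 * (C - K * (1 + 2 * \<zeta>))"
      by (simp add: algebra_simps power_numeral_reduce)
    also have "\<dots> \<le> C * b - b ^ 4 * (b * (C / 4))"
    proof -
      have "b * (C / 4) \<le> C / 4"
        using b K_nonneg \<zeta>_pos unfolding C by (intro mult_left_le_one_le) auto
      also have "\<dots> \<le> C - K * (1 + 2 * \<zeta>)"
      proof -
        have "0 \<le> K * real q" "0 \<le> K * \<zeta>"
          using K_nonneg \<zeta>_pos by auto
        then show ?thesis
          using K_nonneg unfolding C by (simp add: algebra_simps)
      qed
      finally show ?thesis using b by (intro diff_left_mono mult_left_mono) auto
    qed
    also have "\<dots> = C * (b * (1 - b ^ 4 / 4))"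
      by (simp add: algebra_simps)
    also have "\<dots> \<le> C * (real (Suc t) + 1) powr - (1/4)"
    proof (rule mult_left_mono)
      show "b * (1 - b ^ 4 / 4) \<le> (real (Suc t) + 1) powr - (1/4)"
      proof -
        have "1 / (4 * (real t + 1)) = b ^ 4 / 4" by (simp flip: b4)
        moreover have "real (Suc t) + 1 = real t + 1 + 1" by simp
        ultimately show ?thesis
          using powr_minus_quarter_decrement[of "real t + 1"] by (simp only: b_def)
      qed
      show "0 \<le> C" using K_nonneg \<zeta>_pos unfolding C by simp
    qed
    finally show ?thesis .
  qed
qed

text \<open>
  Summation by parts, carried out as an induction. The invariant contains the boundary term
  \<open>(t + 1) powr (3/4) * \<Phi> (t + 1)\<close>, where \<open>\<Phi>\<close> is the regularized objective, so that one step only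
  adds the increment of the inverse step size times \<open>\<Phi>\<close>.
\<close>

lemma upper_sum_bound:
  assumes "t \<ge> q"
  shows "(\<Sum>i\<in>{q<..t}. \<zeta> * (real i + 1) powr - (1/2) * u i)
      \<le> K * (1 + \<zeta>) * (real q + 1 + 4 * real t powr (1/4))"
proof -
  define \<sigma> where "\<sigma> t = \<zeta> * (real t + 1) powr - (1/2)" for t
  define \<Phi> where "\<Phi> t = \<sigma> t * \<phi> t + \<gamma> t" for t
  have \<sigma>_pos: "0 < \<sigma> t" for t unfolding \<sigma>_def using \<zeta>_pos by simp
  have \<Phi>_nonneg: "0 \<le> \<Phi> t" for t
    unfolding \<Phi>_def using \<sigma>_pos[of t] \<phi>_nonneg[of t] \<gamma>_nonneg[of t] by simp
  have \<sigma>_le: "\<sigma> t \<le> \<zeta>" for t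
    unfolding \<sigma>_def using \<zeta>_pos powr_mono2'[of "-(1/2)" 1 "real t + 1"] by simp
  have \<Phi>_le: "\<Phi> t \<le> K * (1 + \<zeta>)" for t
  proof -
    have "\<sigma> t * \<phi> t \<le> \<zeta> * K"
      using \<sigma>_le \<sigma>_pos[of t] \<phi>_le \<phi>_nonneg \<zeta>_pos by (intro mult_mono) auto
    then show ?thesis using \<gamma>_le[of t] unfolding \<Phi>_def by (simp add: algebra_simps)
  qed
  have "(\<Sum>i\<in>{q<..t}. \<sigma> i * u i) + (real t + 1) powr (3/4) * \<Phi> (Suc t)
      \<le> K * (1 + \<zeta>) * (real q + 1 + 4 * (real t powr (1/4) - real q powr (1/4)))"
    using assms
  proof (induction t rule: dec_induct)
    case base
    have "(real q + 1) powr (3/4) * \<Phi> (Suc q) \<le> (real q + 1) * (K * (1 + \<zeta>))"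
      using \<Phi>_le[of "Suc q"] \<Phi>_nonneg[of "Suc q"] powr_mono[of "3/4" 1 "real q + 1"]
      by (intro mult_mono) auto
    then show ?case by (simp add: mult.commute)
  next
    case (step t)
    define i where "i = Suc t"
    define a w where "a = (real i + 1) powr - (3/4)" and "w = (real i + 1) powr (3/4)"
    have i: "i > q" "real i \<ge> 1" "real i = real t + 1" using step unfolding i_def by auto
    have wa: "w * a = 1" unfolding w_def a_def by (simp flip: powr_add)
    have w0: "0 \<le> w" unfolding w_def by simp
    have incr: "w \<le> real i powr (3/4) + real i powr - (1/4)"
      unfolding w_def using i by (intro powr_three_quarters_increment)
    have i_le: "real i powr - (1/4) \<le> 1"
      using powr_mono2'[of "-(1/4)" 1 "real i"] i by auto
    have "\<Phi> (Suc i) \<le> \<sigma> i * \<phi> (Suc i) + \<gamma> (Suc i)"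
      unfolding \<Phi>_def \<sigma>_def using \<zeta>_pos \<phi>_nonneg
      by (intro add_mono mult_right_mono mult_left_mono powr_mono2') auto
    also have "\<dots> \<le> \<Phi> i - a * (\<sigma> i * u i + \<gamma> i) + a * (K * a)"
      using descent[OF i(1) refl refl] unfolding \<Phi>_def \<sigma>_def a_def .
    finally have "w * \<Phi> (Suc i) \<le> w * (\<Phi> i - a * (\<sigma> i * u i + \<gamma> i) + a * (K * a))"
      using w0 by (rule mult_left_mono)
    also have "\<dots> = w * \<Phi> i - (w * a) * (\<sigma> i * u i + \<gamma> i) + (w * a) * (K * a)"
      by (simp add: algebra_simps)
    also have "\<dots> = w * \<Phi> i - \<sigma> i * u i - \<gamma> i + K * a"
      by (simp add: wa)
    finally have "\<sigma> i * u i + w * \<Phi> (Suc i) \<le> w * \<Phi> i - \<gamma> i + K * a" by simp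
    also have "w * \<Phi> i \<le> (real i powr (3/4) + real i powr - (1/4)) * \<Phi> i"
      using incr \<Phi>_nonneg by (rule mult_right_mono)
    also have "\<dots> = real i powr (3/4) * \<Phi> i + real i powr - (1/4) * (\<sigma> i * \<phi> i)
        + real i powr - (1/4) * \<gamma> i"
      by (simp add: \<Phi>_def algebra_simps)
    \<comment> \<open>this cancels the term \<open>- \<gamma> i\<close> supplied by the recursion\<close>
    also have "real i powr - (1/4) * \<gamma> i \<le> \<gamma> i"
      using i_le \<gamma>_nonneg by (intro mult_left_le_one_le) auto
    also have "real i powr - (1/4) * (\<sigma> i * \<phi> i) \<le> real i powr - (1/4) * (\<zeta> * real i powr - (1/2) * K)"
      unfolding \<sigma>_def using i \<zeta>_pos \<phi>_nonneg \<phi>_le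
      by (intro mult_left_mono mult_mono powr_mono2') auto
    also have "\<dots> = K * \<zeta> * real i powr - (3/4)"
      by (simp flip: powr_add)
    also have "K * a \<le> K * real i powr - (3/4)"
      unfolding a_def using i K_nonneg by (intro mult_left_mono powr_mono2') auto
    finally have "\<sigma> i * u i + w * \<Phi> (Suc i) \<le> real i powr (3/4) * \<Phi> i
        + K * (1 + \<zeta>) * real i powr - (3/4)"
      by (simp add: algebra_simps)
    also have "K * (1 + \<zeta>) * real i powr - (3/4)
        \<le> K * (1 + \<zeta>) * (4 * (real i powr (1/4) - real t powr (1/4)))"
      using powr_quarter_increment[OF i(2)] i(3) K_nonneg \<zeta>_pos by (intro mult_left_mono) auto
    finally have new: "\<sigma> i * u i + w * \<Phi> (Suc i) \<le> real i powr (3/4) * \<Phi> i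
        + K * (1 + \<zeta>) * (4 * (real i powr (1/4) - real t powr (1/4)))" by simp
    have "{q<..i} = insert i {q<..t}" using step unfolding i_def by auto
    then have "(\<Sum>j\<in>{q<..i}. \<sigma> j * u j) = \<sigma> i * u i + (\<Sum>j\<in>{q<..t}. \<sigma> j * u j)"
      unfolding i_def by simp
    then have "(\<Sum>j\<in>{q<..i}. \<sigma> j * u j) + w * \<Phi> (Suc i)
        \<le> (\<Sum>j\<in>{q<..t}. \<sigma> j * u j) + real i powr (3/4) * \<Phi> i
          + K * (1 + \<zeta>) * (4 * (real i powr (1/4) - real t powr (1/4)))"
      using new by linarith
    also have "\<dots> \<le> K * (1 + \<zeta>) * (real q + 1 + 4 * (real t powr (1/4) - real q powr (1/4)))
          + K * (1 + \<zeta>) * (4 * (real i powr (1/4) - real t powr (1/4)))"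
      using step.IH unfolding i_def by (simp add: add.commute)
    also have "\<dots> = K * (1 + \<zeta>) * (real q + 1 + 4 * (real i powr (1/4) - real q powr (1/4)))"
      by (simp add: algebra_simps)
    finally show ?case unfolding w_def i_def .
  qed
  moreover have "0 \<le> (real t + 1) powr (3/4) * \<Phi> (Suc t)"
    using \<Phi>_nonneg by simp
  moreover have "K * (1 + \<zeta>) * (real q + 1 + 4 * (real t powr (1/4) - real q powr (1/4)))
      \<le> K * (1 + \<zeta>) * (real q + 1 + 4 * real t powr (1/4))"
    using K_nonneg \<zeta>_pos by (intro mult_left_mono) auto
  ultimately show ?thesis unfolding \<sigma>_def by linarith
qed


lemma lower_gap_tendsto: "\<gamma> \<longlonglongrightarrow> 0"
proof (rule tendsto_sandwich[where f = "\<lambda>_. 0"])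
  let ?C = "K * (real q + 2) + 2 * K * (1 + 2 * \<zeta>)"
  show "\<forall>\<^sub>F t in sequentially. \<gamma> t \<le> ?C * (real t + 1) powr - (1/4)"
    using lower_rate[OF refl] by simp
  show "(\<lambda>t. ?C * (real t + 1) powr - (1/4)) \<longlonglongrightarrow> 0"
    by real_asymp
qed (use \<gamma>_nonneg in auto)

abbreviation \<beta> :: "nat \<Rightarrow> real" where
  "\<beta> \<equiv> avg_weight \<zeta> (1/2) (3/4) q"

text \<open>
  The weighted sum is at most of order \<open>t powr (1/4)\<close> and the total weight at least \<open>c t powr (1/2)\<close>.
  The weights up to \<open>q\<close> contribute a constant.
\<close>

lemma upper_average_rate:
  assumes c: "0 < c" "c * real t powr (1/2) \<le> (\<Sum>i\<le>t. \<beta> i)"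
    and t: "t \<ge> q"
  shows "(\<Sum>i\<le>t. \<beta> i * u i) / (\<Sum>i\<le>t. \<beta> i)
    \<le> (K * (\<Sum>i\<le>q. \<beta> i) + K * (1 + \<zeta>) * (real q + 5)) / c * real t powr - (1/4)"
proof -
  let ?N = "K * (\<Sum>i\<le>q. \<beta> i) + K * (1 + \<zeta>) * (real q + 5)"
  have t1: "1 \<le> real t" using t q_pos by simp
  have "\<beta> i * u i \<le> \<beta> i * K" for i
    using u_bound[of i] avg_weight_pos[OF \<zeta>_pos q_pos, of "1/2" "3/4" i] by (intro mult_left_mono) auto
  then have "(\<Sum>i\<le>q. \<beta> i * u i) \<le> (\<Sum>i\<le>q. \<beta> i * K)"
    by (rule sum_mono)
  also have "\<dots> = K * (\<Sum>i\<le>q. \<beta> i)"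
    by (simp add: sum_distrib_left mult.commute)
  finally have early: "(\<Sum>i\<le>q. \<beta> i * u i) \<le> K * (\<Sum>i\<le>q. \<beta> i)" .
  have W: "0 \<le> (\<Sum>i\<le>q. \<beta> i)"
    using avg_weight_pos[OF \<zeta>_pos q_pos] by (intro sum_nonneg) (auto intro: less_imp_le)
  have "{..t} = {..q} \<union> {q<..t}" using t by auto
  then have "(\<Sum>i\<le>t. \<beta> i * u i) = (\<Sum>i\<le>q. \<beta> i * u i) + (\<Sum>i\<in>{q<..t}. \<beta> i * u i)"
    by (simp add: sum.union_disjoint ivl_disj_int)
  also have "(\<Sum>i\<in>{q<..t}. \<beta> i * u i) = (\<Sum>i\<in>{q<..t}. \<zeta> * (real i + 1) powr - (1/2) * u i)"
    by (intro sum.cong) (auto simp: avg_weight_late)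
  also have "(\<Sum>i\<le>q. \<beta> i * u i) + \<dots>
      \<le> K * (\<Sum>i\<le>q. \<beta> i) + K * (1 + \<zeta>) * (real q + 1 + 4 * real t powr (1/4))"
    using early upper_sum_bound[OF t] by (rule add_mono)
  also have "\<dots> \<le> K * (\<Sum>i\<le>q. \<beta> i) * real t powr (1/4)
      + K * (1 + \<zeta>) * ((real q + 5) * real t powr (1/4))"
  proof (intro add_mono mult_left_mono)
    have ge1: "1 \<le> real t powr (1/4)"
      using t1 by (simp add: ge_one_powr_ge_zero)
    have "0 \<le> K * (\<Sum>i\<le>q. \<beta> i)" using K_nonneg W by simp
    then show "K * (\<Sum>i\<le>q. \<beta> i) \<le> K * (\<Sum>i\<le>q. \<beta> i) * real t powr (1/4)"
      using ge1 mult_left_mono[OF ge1] by fastforce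
    have "(real q + 1) * 1 \<le> (real q + 1) * real t powr (1/4)"
      using ge1 by (intro mult_left_mono) auto
    then show "real q + 1 + 4 * real t powr (1/4) \<le> (real q + 5) * real t powr (1/4)"
      by (simp add: algebra_simps)
    show "0 \<le> K * (1 + \<zeta>)" using K_nonneg \<zeta>_pos by simp
  qed
  also have "\<dots> = ?N * real t powr (1/4)"
    by (simp add: algebra_simps)
  also have "\<dots> = ?N / c * real t powr - (1/4) * (c * real t powr (1/2))"
    using c(1) by (simp flip: powr_add)
  also have "\<dots> \<le> ?N / c * real t powr - (1/4) * (\<Sum>i\<le>t. \<beta> i)"
    using c K_nonneg W \<zeta>_pos by (intro mult_left_mono) auto
  finally have "(\<Sum>i\<le>t. \<beta> i * u i) \<le> ?N / c * real t powr - (1/4) * (\<Sum>i\<le>t. \<beta> i)" .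
  moreover have "0 < (\<Sum>i\<le>t. \<beta> i)"
    using avg_weight_pos[OF \<zeta>_pos q_pos] by (intro sum_pos) auto
  ultimately show ?thesis
    by (simp only: pos_divide_le_eq)
qed

text \<open>
  If \<open>u\<close> were eventually at least \<open>\<epsilon>\<close>, so would be its weighted averages up to the vanishing
  influence of the first terms, because the total weight diverges. But the averages have an upper
  bound that tends to 0.
\<close>

lemma upper_gap_not_bounded_away:
  assumes "0 < \<epsilon>"
  shows "\<not> (\<forall>\<^sub>F t in sequentially. \<epsilon> \<le> u t)"
proof
  assume "\<forall>\<^sub>F t in sequentially. \<epsilon> \<le> u t"
  then obtain N where N: "\<And>t. t \<ge> N \<Longrightarrow> \<epsilon> \<le> u t"
    unfolding eventually_sequentially by blast
  obtain c where c: "0 < c" "\<And>t. t \<ge> q \<Longrightarrow> c * real t powr (1/2) \<le> (\<Sum>i\<le>t. \<beta> i)"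
    using sum_avg_weight_lower[OF \<zeta>_pos q_pos] by blast
  define W A where "W t = (\<Sum>i\<le>t. \<beta> i)" and "A = (K * W q + K * (1 + \<zeta>) * (real q + 5)) / c" for t
  have \<beta>_pos: "0 < \<beta> i" for i using avg_weight_pos[OF \<zeta>_pos q_pos] .
  have W_pos: "0 < W t" for t unfolding W_def using \<beta>_pos by (intro sum_pos) auto
  have "\<epsilon> \<le> A * real t powr - (1/4) + (\<epsilon> + K) * W N / c * real t powr - (1/2)"
    if t: "t \<ge> max N q" for t
  proof -
    have t1: "1 \<le> real t" using t q_pos by simp
    have "- ((\<epsilon> + K) * W N) = (\<Sum>i\<le>t. if i \<le> N then - (\<epsilon> + K) * \<beta> i else 0)"
    proof -
      have "{..t} \<inter> {i. i \<le> N} = {..N}" using t by auto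
      then have "(\<Sum>i\<le>t. if i \<le> N then - (\<epsilon> + K) * \<beta> i else 0) = (\<Sum>i\<le>N. - (\<epsilon> + K) * \<beta> i)"
        by (simp add: sum.If_cases)
      also have "\<dots> = - (\<epsilon> + K) * W N"
        by (simp only: W_def sum_distrib_left)
      finally show ?thesis by (simp only: mult_minus_left)
    qed
    also have "\<dots> \<le> (\<Sum>i\<le>t. \<beta> i * (u i - \<epsilon>))"
    proof (rule sum_mono)
      fix i
      have "\<beta> i * (- (\<epsilon> + K)) \<le> \<beta> i * (u i - \<epsilon>)"
        using \<beta>_pos[of i] u_bound[of i] by (intro mult_left_mono) auto
      moreover have "0 \<le> \<beta> i * (u i - \<epsilon>)" if "N \<le> i"
        using \<beta>_pos[of i] N[OF that] by simp
      ultimately show "(if i \<le> N then - (\<epsilon> + K) * \<beta> i else 0) \<le> \<beta> i * (u i - \<epsilon>)"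
        by (simp add: mult.commute)
    qed
    also have "\<dots> = (\<Sum>i\<le>t. \<beta> i * u i) - \<epsilon> * W t"
      by (simp add: W_def right_diff_distrib sum_subtractf sum_distrib_left mult.commute[of \<epsilon>])
    finally have "\<epsilon> * W t \<le> (\<Sum>i\<le>t. \<beta> i * u i) + (\<epsilon> + K) * W N" by simp
    then have "\<epsilon> \<le> (\<Sum>i\<le>t. \<beta> i * u i) / W t + (\<epsilon> + K) * W N / W t"
      using W_pos[of t] by (simp add: pos_le_divide_eq flip: add_divide_distrib)
    moreover have "(\<Sum>i\<le>t. \<beta> i * u i) / W t \<le> A * real t powr - (1/4)"
      using upper_average_rate[OF c(1) c(2), of t] t unfolding W_def A_def by simp
    moreover have "(\<epsilon> + K) * W N / W t \<le> (\<epsilon> + K) * W N / (c * real t powr (1/2))"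
      using c W_pos K_nonneg assms t t1 less_imp_le[OF W_pos[of N]]
      by (intro divide_left_mono) (auto simp: W_def)
    moreover have "(\<epsilon> + K) * W N / (c * real t powr (1/2)) = (\<epsilon> + K) * W N / c * real t powr - (1/2)"
      by (simp add: powr_minus field_simps)
    ultimately show ?thesis by linarith
  qed
  then have "\<forall>\<^sub>F t in sequentially.
      \<epsilon> \<le> A * real t powr - (1/4) + (\<epsilon> + K) * W N / c * real t powr - (1/2)"
    unfolding eventually_sequentially by blast
  moreover have "(\<lambda>t. A * real t powr - (1/4) + (\<epsilon> + K) * W N / c * real t powr - (1/2)) \<longlonglongrightarrow> 0"
    by real_asymp
  ultimately have "\<epsilon> \<le> 0"
    by (intro tendsto_lowerbound) auto
  then show False using assms by simp
qed

end

section \<open>Sample paths of the algorithm\<close>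

text \<open>
  One realization of the algorithm: the index sequences are arbitrary and all quantities are
  deterministic.
\<close>

locale fscg_path = bilevel_finite_sum X n f g D Lf Lg
  for X :: "'a::euclidean_space set" and n f g D Lf Lg +
  fixes \<zeta> :: real and q :: nat and \<theta> \<xi> :: "nat \<Rightarrow> nat \<Rightarrow> nat"
    and x v Fh Gh :: "nat \<Rightarrow> 'a"
  assumes \<zeta>_pos: "\<zeta> > 0" and q_pos: "q > 0" and n_pos: "n > 0"
    and start: "x 0 \<in> X"
    and indices: "\<And>t j. \<not> q dvd t \<Longrightarrow> j \<in> {1..q} \<Longrightarrow> \<theta> t j \<in> {1..n}"
      "\<And>t j. \<not> q dvd t \<Longrightarrow> j \<in> {1..q} \<Longrightarrow> \<xi> t j \<in> {1..n}"
    and full: "\<And>t. q dvd t \<Longrightarrow> Fh t = grad (finite_avg n f) (x t)"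
      "\<And>t. q dvd t \<Longrightarrow> Gh t = grad (finite_avg n g) (x t)"
    and update: "\<And>t. \<not> q dvd t \<Longrightarrow> Fh t = Fh (t - 1) + (1 / real q) *\<^sub>R
        (\<Sum>j\<in>{1..q}. grad (f (\<theta> t j)) (x t) - grad (f (\<theta> t j)) (x (t - 1)))"
      "\<And>t. \<not> q dvd t \<Longrightarrow> Gh t = Gh (t - 1) + (1 / real q) *\<^sub>R
        (\<Sum>j\<in>{1..q}. grad (g (\<xi> t j)) (x t) - grad (g (\<xi> t j)) (x (t - 1)))"
    and v: "\<And>t. is_arg_min (\<lambda>u. (reg_param \<zeta> (1/2) q t *\<^sub>R Fh t + Gh t) \<bullet> u) (\<lambda>u. u \<in> X) (v t)"
    and step: "\<And>t. x (Suc t) = x t + step_size (3/4) q t *\<^sub>R (v t - x t)"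

lemma (in ir_fscg) fscg_path_at:
  assumes "bilevel_finite_sum X n f g D Lf Lg" "\<zeta> > 0" "q \<in> {1..n}" "S = q"
    and "\<alpha> = step_size (3/4) q" "\<sigma> = reg_param \<zeta> (1/2) q"
    and \<omega>: "\<omega> \<in> space M"
  shows "fscg_path X n f g D Lf Lg \<zeta> q (\<lambda>t j. \<theta> t j \<omega>) (\<lambda>t j. \<xi> t j \<omega>)
    (\<lambda>t. x t \<omega>) (\<lambda>t. v t \<omega>) (\<lambda>t. Fh t \<omega>) (\<lambda>t. Gh t \<omega>)"
proof -
  interpret bilevel_finite_sum X n f g D Lf Lg by fact
  have indices: "\<theta> t j \<omega> \<in> {1..n}" "\<xi> t j \<omega> \<in> {1..n}" if "\<not> q dvd t" "j \<in> {1..q}" for t j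
  proof -
    have meas: "\<theta> t j \<in> measurable M (count_space {1..n})" "\<xi> t j \<in> measurable M (count_space {1..n})"
      using indep_\<theta> indep_\<xi> that \<open>S = q\<close> by (auto simp: indep_vars_def)
    show "\<theta> t j \<omega> \<in> {1..n}" "\<xi> t j \<omega> \<in> {1..n}"
      using measurable_space[OF meas(1) \<omega>] measurable_space[OF meas(2) \<omega>]
      unfolding space_count_space .
  qed
  note params = assms(4-6)
  show ?thesis
  proof unfold_locales
    show "\<zeta> > 0" by fact
    show "q > 0" "n > 0" using assms(3) by auto
    show "x 0 \<omega> \<in> X" using start \<omega> by simp
    show "\<theta> t j \<omega> \<in> {1..n}" "\<xi> t j \<omega> \<in> {1..n}" if "\<not> q dvd t" "j \<in> {1..q}" for t j
      by (rule indices[OF that])+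
    show "Fh t \<omega> = grad (finite_avg n f) (x t \<omega>)" "Gh t \<omega> = grad (finite_avg n g) (x t \<omega>)"
      if "q dvd t" for t
      using full_gradient that \<omega> by blast+
    show "Fh t \<omega> = Fh (t - 1) \<omega> + (1 / real q) *\<^sub>R
        (\<Sum>j\<in>{1..q}. grad (f (\<theta> t j \<omega>)) (x t \<omega>) - grad (f (\<theta> t j \<omega>)) (x (t - 1) \<omega>))"
      if "\<not> q dvd t" for t
      using Fh_update that \<omega> unfolding params by blast
    show "Gh t \<omega> = Gh (t - 1) \<omega> + (1 / real q) *\<^sub>R
        (\<Sum>j\<in>{1..q}. grad (g (\<xi> t j \<omega>)) (x t \<omega>) - grad (g (\<xi> t j \<omega>)) (x (t - 1) \<omega>))"
      if "\<not> q dvd t" for t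
      using Gh_update that \<omega> unfolding params by blast
    show "is_arg_min (\<lambda>u. (reg_param \<zeta> (1/2) q t *\<^sub>R Fh t \<omega> + Gh t \<omega>) \<bullet> u) (\<lambda>u. u \<in> X) (v t \<omega>)" for t
      using v_arg_min \<omega> unfolding params by blast
    show "x (Suc t) \<omega> = x t \<omega> + step_size (3/4) q t *\<^sub>R (v t \<omega> - x t \<omega>)" for t
      using x_update \<omega> unfolding params by blast
  qed
qed

context bilevel_finite_sum
begin

abbreviation F :: "'a \<Rightarrow> real" where "F \<equiv> finite_avg n f"
abbreviation G :: "'a \<Rightarrow> real" where "G \<equiv> finite_avg n g"

lemma C1_near_continuous_on:
  assumes "C1_near X h"
  shows "continuous_on X h"
  using assms unfolding C1_near_def
  by (auto intro!: continuous_at_imp_continuous_on differentiable_imp_continuous_within)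

lemma continuous_G: "continuous_on X G"
  using C1_G by (rule C1_near_continuous_on)

lemma lower_opt_setD:
  assumes "z \<in> lower_opt_set X G"
  shows "z \<in> X" "y \<in> X \<Longrightarrow> G z \<le> G y"
  using assms by (auto simp: lower_opt_set_def is_arg_min_def not_less)

lemma lower_opt_set_nonempty:
  assumes "X \<noteq> {}"
  obtains z where "z \<in> lower_opt_set X G"
  using continuous_attains_inf[OF compact_X assms continuous_G]
  by (force simp: lower_opt_set_def is_arg_min_def not_less)

lemma lower_gap_eq:
  assumes "z \<in> lower_opt_set X G"
  shows "lower_gap X G y = G y - G z"
  unfolding lower_gap_def
  using cInf_eq_minimum[of "G z" "G ` X"] lower_opt_setD[OF assms] by auto

lemma bounded_data:
  obtains B where "B \<ge> 0" "\<And>y. y \<in> X \<Longrightarrow> norm (grad F y) \<le> B"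
    "\<And>y. y \<in> X \<Longrightarrow> \<bar>F y\<bar> \<le> B" "\<And>y. y \<in> X \<Longrightarrow> \<bar>G y\<bar> \<le> B"
proof -
  have bdd: "\<exists>b. \<forall>y\<in>X. norm (h y) \<le> b" if "continuous_on X h" for h :: "'a \<Rightarrow> 'b::real_normed_vector"
    using compact_imp_bounded[OF compact_continuous_image[OF that compact_X]]
    by (auto simp: bounded_iff)
  have "continuous_on X (grad F)"
    using C1_F unfolding C1_near_def by (auto intro: continuous_on_subset)
  then obtain b1 where b1: "\<forall>y\<in>X. norm (grad F y) \<le> b1" using bdd by blast
  obtain b2 where b2: "\<forall>y\<in>X. norm (F y) \<le> b2"
    using bdd C1_near_continuous_on[OF C1_F] by blast
  obtain b3 where b3: "\<forall>y\<in>X. norm (G y) \<le> b3"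
    using bdd continuous_G by blast
  show ?thesis
    using that[of "\<bar>b1\<bar> + \<bar>b2\<bar> + \<bar>b3\<bar>"] b1 b2 b3 by fastforce
qed

lemma upper_gap_bounds:
  assumes "y \<in> X" and B: "norm (grad F y) \<le> B" and z: "z \<in> lower_opt_set X G"
  shows "grad F y \<bullet> (y - z) \<le> upper_gap X F G y" "\<bar>upper_gap X F G y\<bar> \<le> B * D"
proof -
  have abs: "\<bar>grad F y \<bullet> (y - u)\<bar> \<le> B * D" if "u \<in> lower_opt_set X G" for u
  proof -
    have "\<bar>grad F y \<bullet> (y - u)\<bar> \<le> norm (grad F y) * norm (y - u)"
      by (rule Cauchy_Schwarz_ineq2)
    also have "\<dots> \<le> B * D"
      using B diameter_X assms(1) lower_opt_setD(1)[OF that] order_trans[OF norm_ge_zero B]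
      by (intro mult_mono) auto
    finally show ?thesis .
  qed
  show le: "grad F y \<bullet> (y - z) \<le> upper_gap X F G y"
    unfolding upper_gap_def using z abs
    by (intro cSUP_upper bdd_aboveI[of _ "B * D"]) (auto simp: abs_le_iff)
  have "upper_gap X F G y \<le> B * D"
    unfolding upper_gap_def using z abs by (intro cSUP_least) (auto simp: abs_le_iff)
  moreover have "- (B * D) \<le> upper_gap X F G y"
    using le abs[OF z] by linarith
  ultimately show "\<bar>upper_gap X F G y\<bar> \<le> B * D" by simp
qed

text \<open>
  The points of \<open>X\<close> at distance at least \<open>\<delta>\<close> from the lower-level solution set form a compact set,
  on which \<open>G\<close> stays above its minimum over \<open>X\<close> by a positive amount. So the iterates finally have a
  solution within distance \<open>\<delta>\<close>, and comparison with that solution bounds the upper gap below by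
  \<open>- B \<delta>\<close>, where \<open>B\<close> bounds the gradient of \<open>F\<close>.
\<close>

lemma upper_gap_asymp_nonneg:
  assumes x: "\<And>t. x t \<in> X" and lim: "(\<lambda>t. lower_gap X G (x t)) \<longlonglongrightarrow> 0" and "\<epsilon> > 0"
  shows "\<forall>\<^sub>F t in sequentially. - \<epsilon> < upper_gap X F G (x t)"
proof -
  obtain B where B: "B \<ge> 0" "\<And>y. y \<in> X \<Longrightarrow> norm (grad F y) \<le> B"
    using bounded_data by metis
  obtain z where z: "z \<in> lower_opt_set X G"
    using lower_opt_set_nonempty x by blast
  \<comment> \<open>\<open>B + 1\<close> rather than \<open>B\<close>, since \<open>B\<close> may be 0\<close>
  define \<delta> where "\<delta> = \<epsilon> / (B + 1)"
  have \<delta>: "\<delta> > 0" using B(1) \<open>\<epsilon> > 0\<close> by (simp add: \<delta>_def)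
  define far where "far = X - (\<Union>z\<in>lower_opt_set X G. ball z \<delta>)"
  have near: "- \<epsilon> < upper_gap X F G y" if y: "y \<in> X" "y \<notin> far" for y
  proof -
    obtain u where u: "u \<in> lower_opt_set X G" "dist u y < \<delta>"
      using y by (auto simp: far_def)
    have "\<bar>grad F y \<bullet> (y - u)\<bar> \<le> norm (grad F y) * norm (y - u)"
      by (rule Cauchy_Schwarz_ineq2)
    also have "\<dots> \<le> B * \<delta>"
      using u(2) B y(1) \<delta> by (intro mult_mono) (auto simp: dist_norm norm_minus_commute)
    also have "\<dots> < \<epsilon>"
      using B(1) \<open>\<epsilon> > 0\<close> by (simp add: \<delta>_def pos_divide_less_eq field_simps)
    finally show ?thesis
      using upper_gap_bounds(1)[OF y(1) B(2)[OF y(1)] u(1)] by linarith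
  qed
  have "\<forall>\<^sub>F t in sequentially. x t \<notin> far"
  proof (cases "far = {}")
    case False
    have "compact far"
      unfolding far_def using compact_X by (intro compact_diff) auto
    moreover have "continuous_on far G"
      using continuous_G by (rule continuous_on_subset) (auto simp: far_def)
    ultimately obtain k where k: "k \<in> far" "\<And>y. y \<in> far \<Longrightarrow> G k \<le> G y"
      using continuous_attains_inf[of far G] False by blast
    have "G z < G k"
    proof (rule ccontr)
      assume "\<not> G z < G k"
      then have "k \<in> lower_opt_set X G"
        using k(1) lower_opt_setD[OF z]
        by (force simp: lower_opt_set_def is_arg_min_def far_def not_less)
      then show False using k(1) \<delta> by (force simp: far_def)
    qed
    then have "\<forall>\<^sub>F t in sequentially. lower_gap X G (x t) < G k - G z"
      using order_tendstoD(2)[OF lim] by simp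
    then show ?thesis
      by eventually_elim (use k(2) lower_gap_eq[OF z] in force)
  qed simp
  then show ?thesis
    by eventually_elim (use near x in blast)
qed

end

context fscg_path
begin

lemma step_size_bounds: "0 \<le> step_size (3/4) q t" "step_size (3/4) q t \<le> 1"
  "step_size (3/4) q t \<le> (real q + 1) * (real t + 1) powr - (3/4)"
proof -
  note r = ln_over_self_bounds[OF q_pos]
  have le1: "(real t + 1) powr - (3/4) \<le> 1"
    using powr_mono2'[of "-(3/4)" 1 "real t + 1"] by simp
  show "0 \<le> step_size (3/4) q t"
    using r(1) by (simp add: step_size_def)
  show le_one: "step_size (3/4) q t \<le> 1"
    using less_imp_le[OF r(2)] le1 by (cases "t \<le> q") (simp_all only: step_size_def if_True if_False)
  \<comment> \<open>up to time \<open>q\<close> the step size is constant, and the factor \<open>q + 1\<close> compensates for that\<close>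
  show "step_size (3/4) q t \<le> (real q + 1) * (real t + 1) powr - (3/4)"
  proof (cases "t \<le> q")
    case True
    have "(real q + 1) * (real q + 1) powr - 1 \<le> (real q + 1) * (real t + 1) powr - (3/4)"
    proof (rule mult_left_mono)
      have "(real q + 1) powr - 1 \<le> (real q + 1) powr - (3/4)" by (intro powr_mono) auto
      also have "\<dots> \<le> (real t + 1) powr - (3/4)" using True by (intro powr_mono2') auto
      finally show "(real q + 1) powr - 1 \<le> (real t + 1) powr - (3/4)" .
    qed simp
    moreover have "(real q + 1) * (real q + 1) powr - 1 = 1" by (simp add: powr_minus_divide)
    ultimately show ?thesis using le_one by linarith
  next
    case False
    have "1 * (real t + 1) powr - (3/4) \<le> (real q + 1) * (real t + 1) powr - (3/4)"
      by (intro mult_right_mono) auto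
    then show ?thesis using False by (simp add: step_size_def)
  qed
qed

lemma in_X: "v t \<in> X" "x t \<in> X"
proof -
  show v_in: "v t \<in> X" for t using v[of t] by (simp add: is_arg_min_def)
  show "x t \<in> X"
  proof (induction t)
    case (Suc t)
    have "(1 - step_size (3/4) q t) *\<^sub>R x t + step_size (3/4) q t *\<^sub>R v t \<in> X"
      using Suc v_in step_size_bounds[of t] by (intro convexD[OF convex_X]) auto
    then show ?case by (simp add: step algebra_simps)
  qed (rule start)
qed

lemma D_nonneg: "0 \<le> D"
  using diameter_X start by force

lemma step_norm:
  "norm (x (Suc t) - x t) \<le> step_size (3/4) q t * D"
  using diameter_X in_X[of t] step_size_bounds(1)[of t] by (simp add: step mult_left_mono)

lemma estimator_errors:
  shows "norm (Fh t - grad F (x t))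
      \<le> 2 * Lf * ((real q + 1) * D) * real q ^ 2 * (real t + 1) powr - (3/4)"
    and "norm (Gh t - grad G (x t))
      \<le> 2 * Lg * ((real q + 1) * D) * real q ^ 2 * (real t + 1) powr - (3/4)"
proof -
  have L: "0 \<le> Lf" "0 \<le> Lg"
    using lipschitz_f lipschitz_g n_pos lipschitz_on_nonneg[of _ X "grad (f 1)"]
      lipschitz_on_nonneg[of _ X "grad (g 1)"] by auto
  have "step_size (3/4) q t * D \<le> ((real q + 1) * (real t + 1) powr - (3/4)) * D" for t
    using step_size_bounds(3) D_nonneg by (rule mult_right_mono)
  then have moves: "norm (x (Suc t) - x t) \<le> ((real q + 1) * D) * (real t + 1) powr - (3/4)" for t
    using step_norm[of t] by (smt (verit) mult.assoc mult.commute)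
  have c: "0 \<le> (real q + 1) * D" using D_nonneg by simp
  show "norm (Fh t - grad F (x t))
      \<le> 2 * Lf * ((real q + 1) * D) * real q ^ 2 * (real t + 1) powr - (3/4)"
    by (rule recursive_estimator_error[OF q_pos c L(1) full(1) update(1) indices(1) in_X(2)
          lipschitz_f[rule_format] lipschitz_grad_finite_avg[OF n_pos C1_f lipschitz_f] moves])
  show "norm (Gh t - grad G (x t))
      \<le> 2 * Lg * ((real q + 1) * D) * real q ^ 2 * (real t + 1) powr - (3/4)"
    by (rule recursive_estimator_error[OF q_pos c L(2) full(2) update(2) indices(2) in_X(2)
          lipschitz_g[rule_format] lipschitz_grad_finite_avg[OF n_pos C1_g lipschitz_g] moves])
qed

text \<open>
  Adding \<open>B\<close> makes the values of \<open>F\<close> nonnegative. The one-step inequality is applied with every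
  lower-level solution as comparison point, and the supremum over these points gives the upper gap.
  The constant \<open>K\<close> depends only on the problem data, \<open>\<zeta>\<close> and \<open>q\<close>, so it serves all sample paths at once.
\<close>

lemma path_recursion:
  assumes B: "B \<ge> 0" "\<And>y. y \<in> X \<Longrightarrow> norm (grad F y) \<le> B"
    "\<And>y. y \<in> X \<Longrightarrow> \<bar>F y\<bar> \<le> B" "\<And>y. y \<in> X \<Longrightarrow> \<bar>G y\<bar> \<le> B"
    and K: "K = 2 * B + B * D + 2 * D\<^sup>2 * (\<zeta> * Lf + Lg) * ((real q + 1) * real q ^ 2 + 1)"
  shows "bilevel_recursion \<zeta> K q (\<lambda>t. F (x t) + B) (\<lambda>t. lower_gap X G (x t))
    (\<lambda>t. upper_gap X F G (x t))"
proof -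
  obtain z where z: "z \<in> lower_opt_set X G"
    using lower_opt_set_nonempty start by blast
  have Lip: "Lf-lipschitz_on X (grad F)" "Lg-lipschitz_on X (grad G)"
    using lipschitz_grad_finite_avg[OF n_pos] C1_f C1_g lipschitz_f lipschitz_g by blast+
  then have L: "0 \<le> Lf" "0 \<le> Lg" by (auto dest: lipschitz_on_nonneg)
  have BD: "0 \<le> B * D" using B(1) D_nonneg by simp
  define Ke where "Ke = 2 * D\<^sup>2 * (\<zeta> * Lf + Lg) * ((real q + 1) * real q ^ 2 + 1)"
  have Ke: "0 \<le> Ke" unfolding Ke_def using L \<zeta>_pos by simp
  have K2: "2 * B \<le> K" "B * D \<le> K" "Ke \<le> K"
    using BD Ke B(1) unfolding K Ke_def[symmetric] by auto
  show ?thesis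
  proof
    show "\<zeta> > 0" "q > 0" by (rule \<zeta>_pos q_pos)+
  next
    fix t
    show "0 \<le> F (x t) + B" using B(3)[OF in_X(2), of t] by linarith
    show "F (x t) + B \<le> K" using B(3)[OF in_X(2), of t] K2 by linarith
    show "0 \<le> lower_gap X G (x t)"
      using lower_gap_eq[OF z] lower_opt_setD(2)[OF z in_X(2)] by simp
    show "lower_gap X G (x t) \<le> K"
      using lower_gap_eq[OF z, of "x t"] B(4)[OF in_X(2), of t] B(4)[OF lower_opt_setD(1)[OF z]] K2
      by linarith
    show "\<bar>upper_gap X F G (x t)\<bar> \<le> K"
      using upper_gap_bounds(2)[OF in_X(2) B(2)[OF in_X(2)] z, of t] K2 by linarith
  next
    fix t assume t: "t > q"
    obtain y where y: "y \<in> X" "F (x (Suc t)) - F (x t) = grad F y \<bullet> (x (Suc t) - x t)"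
      using gradient_mvt[OF convex_X in_X(2) in_X(2) C1_near_GDERIV[OF C1_F]] by metis
    have "\<bar>grad F y \<bullet> (x (Suc t) - x t)\<bar> \<le> norm (grad F y) * norm (x (Suc t) - x t)"
      by (rule Cauchy_Schwarz_ineq2)
    also have "\<dots> \<le> B * (step_size (3/4) q t * D)"
      using B y(1) step_norm by (intro mult_mono) auto
    also have "\<dots> = B * D * (real t + 1) powr - (3/4)"
      using t by (simp add: step_size_def)
    also have "\<dots> \<le> K * (real t + 1) powr - (3/4)"
      using K2 by (intro mult_right_mono) auto
    finally show "\<bar>F (x (Suc t)) + B - (F (x t) + B)\<bar> \<le> K * (real t + 1) powr - (3/4)"
      using y(2) by simp
  next
    fix t s a
    assume t: "t > q" and s: "s = \<zeta> * (real t + 1) powr - (1/2)" and a: "a = (real t + 1) powr - (3/4)"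
    let ?\<gamma> = "\<lambda>t. lower_gap X G (x t)" and ?u = "upper_gap X F G (x t)"
    have s_eq: "reg_param \<zeta> (1/2) q t = s"
      unfolding s reg_param_def using t by (simp add: max.absorb1)
    have a_eq: "step_size (3/4) q t = a"
      unfolding a step_size_def using t by simp
    have s0: "0 < s" unfolding s using \<zeta>_pos by simp
    have s_le: "s \<le> \<zeta>"
      unfolding s using \<zeta>_pos powr_mono2'[of "-(1/2)" 1 "real t + 1"] by simp
    have a0: "0 < a" unfolding a by simp
    define E where "E = 2 * ((real q + 1) * D) * real q ^ 2 * a"
    have E0: "0 \<le> E" unfolding E_def using D_nonneg a0 by simp
    have errF: "norm (Fh t - grad F (x t)) \<le> Lf * E" and errG: "norm (Gh t - grad G (x t)) \<le> Lg * E"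
      using estimator_errors[of t] unfolding E_def a by (simp_all add: algebra_simps)
    have err: "a * (D * (s * norm (Fh t - grad F (x t)) + norm (Gh t - grad G (x t))))
        \<le> a * (D * ((\<zeta> * Lf + Lg) * E))"
    proof (intro mult_left_mono)
      have "s * norm (Fh t - grad F (x t)) \<le> \<zeta> * (Lf * E)"
        using s_le s0 errF \<zeta>_pos by (intro mult_mono) auto
      then show "s * norm (Fh t - grad F (x t)) + norm (Gh t - grad G (x t)) \<le> (\<zeta> * Lf + Lg) * E"
        using errG by (simp add: algebra_simps)
    qed (use a0 D_nonneg in auto)
    have curv: "a\<^sup>2 * D\<^sup>2 * (s * Lf + Lg) \<le> 2 * (a\<^sup>2 * D\<^sup>2 * (\<zeta> * Lf + Lg))"
    proof -
      have "s * Lf + Lg \<le> \<zeta> * Lf + Lg" using s_le L by (simp add: mult_right_mono)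
      then have "a\<^sup>2 * D\<^sup>2 * (s * Lf + Lg) \<le> a\<^sup>2 * D\<^sup>2 * (\<zeta> * Lf + Lg)"
        by (intro mult_left_mono) auto
      moreover have "0 \<le> a\<^sup>2 * D\<^sup>2 * (\<zeta> * Lf + Lg)" using L \<zeta>_pos by simp
      ultimately show ?thesis by linarith
    qed
    have total: "a * (D * ((\<zeta> * Lf + Lg) * E)) + 2 * (a\<^sup>2 * D\<^sup>2 * (\<zeta> * Lf + Lg)) = a * (Ke * a)"
      unfolding Ke_def E_def by (simp add: algebra_simps power2_eq_square)
    \<comment> \<open>the one-step inequality solved for the term with the gradient of \<open>F\<close>\<close>
    define R where "R = s * F (x t) + G (x t) - s * F (x (Suc t)) - G (x (Suc t))
      - a * (G (x t) - G z) + a * (Ke * a)"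
    have step_u: "a * s * (grad F (x t) \<bullet> (x t - u)) \<le> R" if u: "u \<in> lower_opt_set X G" for u
    proof -
      have "G u = G z"
        using lower_opt_setD[OF u] lower_opt_setD[OF z] by (meson order_antisym)
      moreover have "s * F (x (Suc t)) + G (x (Suc t)) \<le> s * F (x t) + G (x t)
          - a * (s * (grad F (x t) \<bullet> (x t - u)) + (G (x t) - G u))
          + a * (D * (s * norm (Fh t - grad F (x t)) + norm (Gh t - grad G (x t))))
          + a\<^sup>2 * D\<^sup>2 * (s * Lf + Lg)"
        using diameter_X step_size_bounds[of t] s0 v[of t] step[of t]
        by (intro frank_wolfe_step[where X = X and v = "v t"] convex_X in_X lower_opt_setD(1)[OF u]
            C1_near_GDERIV[OF C1_F] C1_near_GDERIV[OF C1_G] Lip convex_G)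
          (auto simp: s_eq a_eq)
      ultimately show ?thesis
        using err curv total unfolding R_def by (simp add: algebra_simps)
    qed
    have "?u \<le> R / (a * s)"
      unfolding upper_gap_def
    proof (rule cSUP_least)
      fix u assume "u \<in> lower_opt_set X G"
      then show "grad F (x t) \<bullet> (x t - u) \<le> R / (a * s)"
        using step_u a0 s0 by (simp add: pos_le_divide_eq mult.commute)
    qed (use z in auto)
    then have "a * s * ?u \<le> R"
      using a0 s0 by (simp add: pos_le_divide_eq mult.commute)
    moreover have "a * (Ke * a) \<le> a * (K * a)"
      using K2 a0 by (intro mult_left_mono mult_right_mono) auto
    ultimately show "s * (F (x (Suc t)) + B) + ?\<gamma> (Suc t)
        \<le> s * (F (x t) + B) + ?\<gamma> t - a * (s * ?u + ?\<gamma> t) + a * (K * a)"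
      unfolding R_def lower_gap_eq[OF z] by (simp add: algebra_simps)
  qed
qed

end

section \<open>Rates and limits\<close>

lemma liminf_eq_zeroI:
  fixes u :: "nat \<Rightarrow> real"
  assumes lower: "\<And>\<epsilon>. \<epsilon> > 0 \<Longrightarrow> \<forall>\<^sub>F t in sequentially. - \<epsilon> < u t"
    and upper: "\<And>\<epsilon>. \<epsilon> > 0 \<Longrightarrow> \<not> (\<forall>\<^sub>F t in sequentially. \<epsilon> \<le> u t)"
  shows "liminf (\<lambda>t. ereal (u t)) = 0"
proof (rule antisym)
  show "0 \<le> liminf (\<lambda>t. ereal (u t))"
    unfolding le_Liminf_iff
  proof (intro allI impI)
    fix y :: ereal assume "y < 0"
    then obtain r where r: "y < ereal r" "ereal r < 0"
      using ereal_dense2 by blast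
    have "\<forall>\<^sub>F t in sequentially. r < u t"
      using lower[of "- r"] r(2) by simp
    then show "\<forall>\<^sub>F t in sequentially. y < ereal (u t)"
      by eventually_elim (use r(1) in \<open>force intro: less_trans\<close>)
  qed
  show "liminf (\<lambda>t. ereal (u t)) \<le> 0"
  proof (rule ccontr)
    assume "\<not> ?thesis"
    then have "0 < liminf (\<lambda>t. ereal (u t))" by (simp add: not_le)
    then obtain \<epsilon> where \<epsilon>: "0 < ereal \<epsilon>" "ereal \<epsilon> < liminf (\<lambda>t. ereal (u t))"
      using ereal_dense2 by blast
    have "\<forall>\<^sub>F t in sequentially. \<epsilon> \<le> u t"
      using less_LiminfD[OF \<epsilon>(2)] by eventually_elim simp
    then show False using upper[of \<epsilon>] \<epsilon>(1) by simp
  qed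
qed

text \<open>
  The logarithm in the probabilistic bound can be appended to any pathwise bound.
\<close>

lemma ln_confidence_ge_1:
  assumes "1 \<le> d" "0 < \<delta>" "\<delta> < 1"
  shows "1 \<le> ln (8 * real d * (real t + 2)\<^sup>2 / \<delta>)"
proof -
  have "8 * 1 * 1 \<le> 8 * real d * (real t + 2)\<^sup>2"
    using assms(1) by (intro mult_mono) (auto simp: one_le_power)
  moreover have "8 * real d * (real t + 2)\<^sup>2 * 1 \<le> 8 * real d * (real t + 2)\<^sup>2 * (1 / \<delta>)"
    using assms by (intro mult_left_mono) auto
  ultimately have "exp 1 \<le> 8 * real d * (real t + 2)\<^sup>2 / \<delta>"
    using exp_le by simp
  then show ?thesis
    by (metis exp_gt_zero ln_exp ln_le_cancel_iff order_less_le_trans)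
qed

theorem (in bilevel_finite_sum) pathwise_rates:
  assumes "\<zeta> > 0" "q > 0"
  obtains C where "C > 0"
    and "\<And>\<theta> \<xi> x v Fh Gh t. fscg_path X n f g D Lf Lg \<zeta> q \<theta> \<xi> x v Fh Gh \<Longrightarrow> t \<ge> q \<Longrightarrow>
      (\<Sum>i\<le>t. avg_weight \<zeta> (1/2) (3/4) q i * upper_gap X F G (x i))
        / (\<Sum>i\<le>t. avg_weight \<zeta> (1/2) (3/4) q i) \<le> C * real t powr - (1/4)"
    and "\<And>\<theta> \<xi> x v Fh Gh t. fscg_path X n f g D Lf Lg \<zeta> q \<theta> \<xi> x v Fh Gh \<Longrightarrow> t \<ge> q \<Longrightarrow>
      lower_gap X G (x t) \<le> C * real t powr - (1/4)"
proof -
  obtain B where B: "B \<ge> 0" "\<And>y. y \<in> X \<Longrightarrow> norm (grad F y) \<le> B"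
    "\<And>y. y \<in> X \<Longrightarrow> \<bar>F y\<bar> \<le> B" "\<And>y. y \<in> X \<Longrightarrow> \<bar>G y\<bar> \<le> B"
    using bounded_data by metis
  obtain c where c: "0 < c"
    "\<And>t. t \<ge> q \<Longrightarrow> c * real t powr (1/2) \<le> (\<Sum>i\<le>t. avg_weight \<zeta> (1/2) (3/4) q i)"
    using sum_avg_weight_lower[OF assms] by blast
  define K where "K = 2 * B + B * D + 2 * D\<^sup>2 * (\<zeta> * Lf + Lg) * ((real q + 1) * real q ^ 2 + 1)"
  define C1 where "C1 = K * (real q + 2) + 2 * K * (1 + 2 * \<zeta>)"
  define C2 where "C2 = (K * (\<Sum>i\<le>q. avg_weight \<zeta> (1/2) (3/4) q i) + K * (1 + \<zeta>) * (real q + 5)) / c"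
  define C where "C = \<bar>C1\<bar> + \<bar>C2\<bar> + 1"
  show ?thesis
  proof (rule that)
    show "C > 0" by (simp add: C_def)
  next
    fix \<theta> \<xi> x v Fh Gh t
    assume path: "fscg_path X n f g D Lf Lg \<zeta> q \<theta> \<xi> x v Fh Gh" and t: "t \<ge> q"
    interpret path: fscg_path X n f g D Lf Lg \<zeta> q \<theta> \<xi> x v Fh Gh by fact
    interpret bilevel_recursion \<zeta> K q "\<lambda>t. F (x t) + B" "\<lambda>t. lower_gap X G (x t)"
      "\<lambda>t. upper_gap X F G (x t)"
      using B K_def by (rule path.path_recursion)
    have "C2 * real t powr - (1/4) \<le> C * real t powr - (1/4)"
      by (intro mult_right_mono) (auto simp: C_def)
    then show "(\<Sum>i\<le>t. \<beta> i * upper_gap X F G (x i)) / (\<Sum>i\<le>t. \<beta> i) \<le> C * real t powr - (1/4)"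
      using upper_average_rate[OF c(1) c(2)[OF t] t, folded C2_def] by (rule order_trans[rotated])
    have "C1 * (real t + 1) powr - (1/4) \<le> C * real t powr - (1/4)"
      using t assms(2) by (intro mult_mono powr_mono2') (auto simp: C_def)
    with lower_rate[OF C1_def] show "lower_gap X G (x t) \<le> C * real t powr - (1/4)"
      by (rule order_trans)
  qed
qed

theorem (in fscg_path) pathwise_limits:
  "liminf (\<lambda>t. ereal (upper_gap X F G (x t))) = 0" "(\<lambda>t. lower_gap X G (x t)) \<longlonglongrightarrow> 0"
proof -
  obtain B where B: "B \<ge> 0" "\<And>y. y \<in> X \<Longrightarrow> norm (grad F y) \<le> B"
    "\<And>y. y \<in> X \<Longrightarrow> \<bar>F y\<bar> \<le> B" "\<And>y. y \<in> X \<Longrightarrow> \<bar>G y\<bar> \<le> B"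
    using bounded_data by metis
  interpret bilevel_recursion \<zeta>
    "2 * B + B * D + 2 * D\<^sup>2 * (\<zeta> * Lf + Lg) * ((real q + 1) * real q ^ 2 + 1)" q
    "\<lambda>t. F (x t) + B" "\<lambda>t. lower_gap X G (x t)" "\<lambda>t. upper_gap X F G (x t)"
    using B refl by (rule path_recursion)
  show "(\<lambda>t. lower_gap X G (x t)) \<longlonglongrightarrow> 0" by (rule lower_gap_tendsto)
  show "liminf (\<lambda>t. ereal (upper_gap X F G (x t))) = 0"
    by (rule liminf_eq_zeroI[OF upper_gap_asymp_nonneg[OF in_X(2) lower_gap_tendsto]
          upper_gap_not_bounded_away])
qed

theorem theorem4:
  fixes X :: "'a::euclidean_space set"
    and n q :: nat
    and f g :: "nat \<Rightarrow> 'a \<Rightarrow> real"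
    and D Lf Lg \<zeta> :: real
  defines "F \<equiv> finite_avg n f" and "G \<equiv> finite_avg n g"
    and "p \<equiv> 1/2" and "w \<equiv> 3/4"
  assumes problem: "bilevel_finite_sum X n f g D Lf Lg"
    and \<zeta>: "\<zeta> > 0"
    and q: "q \<in> {1..n}"
  shows "\<exists>C>0. \<forall>(M :: 'w measure) \<theta> \<xi> x v Fh Gh x0.
    ir_fscg M X n f g (step_size w q) (reg_param \<zeta> p q) q q \<theta> \<xi> x v Fh Gh x0 \<longrightarrow>
      (\<forall>\<delta>\<in>{0<..<1}.
         measure M {\<omega> \<in> space M. \<forall>t\<ge>q.
             (\<Sum>i\<le>t. avg_weight \<zeta> p w q i * upper_gap X F G (x i \<omega>))
                 / (\<Sum>i\<le>t. avg_weight \<zeta> p w q i)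
               \<le> C * real t powr (-1/4) * ln (8 * real DIM('a) * (real t + 2)^2 / \<delta>)
           \<and> lower_gap X G (x t \<omega>)
               \<le> C * real t powr (-1/4) * ln (8 * real DIM('a) * (real t + 2)^2 / \<delta>)}
         \<ge> 1 - \<delta>)
      \<and> (AE \<omega> in M. liminf (\<lambda>t. ereal (upper_gap X F G (x t \<omega>))) = 0
                   \<and> (\<lambda>t. lower_gap X G (x t \<omega>)) \<longlonglongrightarrow> 0)"
proof -
  interpret bilevel_finite_sum X n f g D Lf Lg by (rule problem)
  have "q > 0" using q by simp
  obtain C where C: "C > 0"
    and upper: "\<And>\<theta> \<xi> x v Fh Gh t. fscg_path X n f g D Lf Lg \<zeta> q \<theta> \<xi> x v Fh Gh \<Longrightarrow> t \<ge> q \<Longrightarrow>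
      (\<Sum>i\<le>t. avg_weight \<zeta> p w q i * upper_gap X F G (x i))
        / (\<Sum>i\<le>t. avg_weight \<zeta> p w q i) \<le> C * real t powr - (1/4)"
    and lower: "\<And>\<theta> \<xi> x v Fh Gh t. fscg_path X n f g D Lf Lg \<zeta> q \<theta> \<xi> x v Fh Gh \<Longrightarrow> t \<ge> q \<Longrightarrow>
      lower_gap X G (x t) \<le> C * real t powr - (1/4)"
  proof (rule pathwise_rates[OF \<zeta> \<open>q > 0\<close>, folded F_def G_def p_def w_def], goal_cases)
    case (1 C)
    from 1(2-4) show ?case by (rule 1(1))
  qed
  show ?thesis
  proof (intro exI[of _ C] conjI C allI impI ballI)
    fix M :: "'w measure" and \<theta> \<xi> x v Fh Gh x0
    assume "ir_fscg M X n f g (step_size w q) (reg_param \<zeta> p q) q q \<theta> \<xi> x v Fh Gh x0"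
    then interpret ir_fscg M X n f g "step_size w q" "reg_param \<zeta> p q" q q \<theta> \<xi> x v Fh Gh x0 .
    have path: "fscg_path X n f g D Lf Lg \<zeta> q (\<lambda>t j. \<theta> t j \<omega>) (\<lambda>t j. \<xi> t j \<omega>)
        (\<lambda>t. x t \<omega>) (\<lambda>t. v t \<omega>) (\<lambda>t. Fh t \<omega>) (\<lambda>t. Gh t \<omega>)" if "\<omega> \<in> space M" for \<omega>
      by (rule fscg_path_at[OF problem \<zeta> q refl _ _ that]) (simp_all only: p_def w_def)
    show "AE \<omega> in M. liminf (\<lambda>t. ereal (upper_gap X F G (x t \<omega>))) = 0
                   \<and> (\<lambda>t. lower_gap X G (x t \<omega>)) \<longlonglongrightarrow> 0"
      unfolding F_def G_def
      by (rule AE_I2) (intro conjI fscg_path.pathwise_limits[OF path])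
    fix \<delta> :: real assume \<delta>: "\<delta> \<in> {0<..<1}"
    let ?r = "\<lambda>t. C * real t powr (-1/4) * ln (8 * real DIM('a) * (real t + 2)^2 / \<delta>)"
    let ?good = "{\<omega> \<in> space M. \<forall>t\<ge>q.
             (\<Sum>i\<le>t. avg_weight \<zeta> p w q i * upper_gap X F G (x i \<omega>))
                 / (\<Sum>i\<le>t. avg_weight \<zeta> p w q i) \<le> ?r t
           \<and> lower_gap X G (x t \<omega>) \<le> ?r t}"
    have rate: "C * real t powr - (1/4) \<le> ?r t" for t
    proof -
      have "1 \<le> DIM('a)" using DIM_positive[where 'a = 'a] by linarith
      then have "1 \<le> ln (8 * real DIM('a) * (real t + 2)^2 / \<delta>)"
        using \<delta> by (intro ln_confidence_ge_1) auto
      then have "C * real t powr - (1/4) * 1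
          \<le> C * real t powr - (1/4) * ln (8 * real DIM('a) * (real t + 2)^2 / \<delta>)"
        using C by (intro mult_left_mono) auto
      then show ?thesis by simp
    qed
    have "?good = space M"
      using order_trans[OF upper[OF path] rate] order_trans[OF lower[OF path] rate]
      by (intro set_eqI iffI CollectI conjI allI impI) simp_all
    then have "measure M ?good = 1"
      by (simp only: prob_space)
    moreover have "1 - \<delta> \<le> 1" using \<delta> by simp
    ultimately show "1 - \<delta> \<le> measure M ?good" by (simp only:)
  qed
qed

end
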